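(* Let $(X,\varphi,g)$ be a Riemannian $7$-manifold with holonomy contained in $G_2$, let $\Sigma$ be an oriented surface and let $f:\Sigma\to X$ be an immersion. Let $\pi:Z_7\to X$ be the unit tangent sphere bundle, let $\mathcal{E}$ be its canonical distribution, $\mathcal{E}_\eta=\pi_*^{-1}(\langle\eta\rangle^\perp)\subseteq T_\eta Z_7$, and let $\tilde f_7:\Sigma\to Z_7$ be the $7$-dimensional Gauss lift of $f$. Then $\tilde f_7(\Sigma)$ is an (immersed) integral submanifold of the distribution $\mathcal{E}$, i.e. $\tilde f_{7*}(T_p\Sigma)\subseteq\mathcal{E}_{\tilde f_7(p)}$ for all $p\in\Sigma$.
   Context: Let $\varphi_0=\varepsilon^{123}+\varepsilon^1\wedge(\varepsilon^{45}-\varepsilon^{67})+\varepsilon^2\wedge(\varepsilon^{46}-\varepsilon^{75})+\varepsilon^3\wedge(\varepsilon^{47}-\varepsilon^{56})$ on $\mathbb{R}^7$, where $\{\varepsilon^i\}$ is the dual of the standard basis and $\varepsilon^{ij}=\varepsilon^i\wedge\varepsilon^j$, etc. A Riemannian $7$-manifold $(X,\varphi,g)$ with holonomy contained in $G_2$ is a $7$-manifold with a smooth $3$-form $\varphi$ such that at each point there is a basis $\{e_i\}$ of the tangent space with dual coframe $\{\varepsilon^i\}$ in which $\varphi$ has the form $\varphi_0$; $g$ is the metric determined by $\varphi$ (for which such bases $\{e_i\}$ are orthonormal), and $\varphi$ is parallel for the Levi-Civita connection of $g$. The vector cross product on each tangent space is defined by $g(u,v\times w)=\varphi(u,v,w)$.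 For an oriented $2$-plane $\xi\subseteq T_xX$ with oriented orthonormal basis $\{u,v\}$, put $\eta(\xi)=u\times v$; this is a unit vector orthogonal to $\xi$ and independent of the chosen oriented orthonormal basis. $Z_7$ is the unit sphere bundle of $TX$, with projection $\pi:Z_7\to X$. For $\eta\in Z_7$ with $\pi(\eta)=x$, $\langle\eta\rangle^\perp\subseteq T_xX$ is the $g$-orthogonal complement of $\eta$. For an immersion $f:\Sigma\to X$ of an oriented surface, the $7$-dimensional Gauss lift is $\tilde f_7:\Sigma\to Z_7$, $\tilde f_7(p)=\eta(f_*(T_p\Sigma))\in T_{f(p)}X$, where $f_*(T_p\Sigma)$ carries the orientation induced from $\Sigma$. *)

theory Defs
  imports "HOL-Analysis.Analysis"
begin

section \<open>Smooth maps between Euclidean spaces\<close>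

text \<open>To be used on open sets only. On open subsets of a finite-dimensional space, \<open>Ck_on k\<close> is
  continuous differentiability of order \<open>k\<close>.\<close>

primrec Ck_on :: "nat \<Rightarrow> 'a::real_normed_vector set \<Rightarrow> ('a \<Rightarrow> 'b::real_normed_vector) \<Rightarrow> bool" where
  "Ck_on 0 S f \<longleftrightarrow> continuous_on S f"
| "Ck_on (Suc k) S f \<longleftrightarrow> (\<forall>x\<in>S. f differentiable (at x)) \<and>
     (\<forall>v. Ck_on k S (\<lambda>x. frechet_derivative f (at x) v))"

definition smooth_on :: "'a::real_normed_vector set \<Rightarrow> ('a \<Rightarrow> 'b::real_normed_vector) \<Rightarrow> bool" where
  "smooth_on S f \<longleftrightarrow> (\<forall>k. Ck_on k S f)"


section \<open>Smooth manifolds\<close>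

text \<open>A chart is its domain together with the coordinate map; the values of the map outside the
  domain are irrelevant. A manifold is given by a (not necessarily maximal) atlas: the point set
  and the topology are those determined by the charts.\<close>

type_synonym ('a, 'e) chart = "'a set \<times> ('a \<Rightarrow> 'e)"

definition points :: "('a, 'e) chart set \<Rightarrow> 'a set" where
  "points A = \<Union> (fst ` A)"

definition local_rep :: "('a, 'e) chart \<Rightarrow> ('b, 'f) chart \<Rightarrow> ('a \<Rightarrow> 'b) \<Rightarrow> 'e \<Rightarrow> 'f" where
  "local_rep \<kappa> \<mu> f = snd \<mu> \<circ> f \<circ> inv_into (fst \<kappa>) (snd \<kappa>)"

abbreviation transition :: "('a, 'e) chart \<Rightarrow> ('a, 'f) chart \<Rightarrow> 'e \<Rightarrow> 'f" where
  "transition \<kappa> \<mu> \<equiv> local_rep \<kappa> \<mu> (\<lambda>x. x)"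

definition smooth_atlas :: "('a, 'e::euclidean_space) chart set \<Rightarrow> bool" where
  "smooth_atlas A \<longleftrightarrow>
     (\<forall>\<kappa>\<in>A. inj_on (snd \<kappa>) (fst \<kappa>) \<and> open (snd \<kappa> ` fst \<kappa>)) \<and>
     (\<forall>\<kappa>\<in>A. \<forall>\<mu>\<in>A. open (snd \<kappa> ` (fst \<kappa> \<inter> fst \<mu>)) \<and>
        smooth_on (snd \<kappa> ` (fst \<kappa> \<inter> fst \<mu>)) (transition \<kappa> \<mu>))"

definition manifold_open :: "('a, 'e::euclidean_space) chart set \<Rightarrow> 'a set \<Rightarrow> bool" where
  "manifold_open A W \<longleftrightarrow> W \<subseteq> points A \<and> (\<forall>\<kappa>\<in>A. open (snd \<kappa> ` (W \<inter> fst \<kappa>)))"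

definition manifold_topology :: "('a, 'e::euclidean_space) chart set \<Rightarrow> 'a topology" where
  "manifold_topology A = topology (manifold_open A)"

lemma openin_manifold_topology:
  assumes "smooth_atlas A"
  shows "openin (manifold_topology A) = manifold_open A"
proof -
  have "manifold_open A (S \<inter> T)" if S: "manifold_open A S" and T: "manifold_open A T" for S T
    unfolding manifold_open_def
  proof (intro conjI ballI)
    show "S \<inter> T \<subseteq> points A"
      using S unfolding manifold_open_def by blast
    fix \<kappa> assume \<kappa>: "\<kappa> \<in> A"
    have inj: "inj_on (snd \<kappa>) (fst \<kappa>)"
      using assms \<kappa> unfolding smooth_atlas_def by blast
    have "snd \<kappa> ` (S \<inter> T \<inter> fst \<kappa>) = snd \<kappa> ` (S \<inter> fst \<kappa>) \<inter> snd \<kappa> ` (T \<inter> fst \<kappa>)"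
      using inj unfolding inj_on_def by blast
    then show "open (snd \<kappa> ` (S \<inter> T \<inter> fst \<kappa>))"
      using S T \<kappa> unfolding manifold_open_def by (metis open_Int)
  qed
  moreover have "manifold_open A (\<Union>\<K>)" if "\<forall>K\<in>\<K>. manifold_open A K" for \<K>
    unfolding manifold_open_def
  proof (intro conjI ballI)
    show "\<Union>\<K> \<subseteq> points A"
      using that unfolding manifold_open_def by blast
    fix \<kappa> assume \<kappa>: "\<kappa> \<in> A"
    have "snd \<kappa> ` (\<Union>\<K> \<inter> fst \<kappa>) = (\<Union>K\<in>\<K>. snd \<kappa> ` (K \<inter> fst \<kappa>))"
      by blast
    then show "open (snd \<kappa> ` (\<Union>\<K> \<inter> fst \<kappa>))"
      using that \<kappa> unfolding manifold_open_def by auto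
  qed
  ultimately have "istopology (manifold_open A)"
    unfolding istopology_def by blast
  then show ?thesis
    unfolding manifold_topology_def by (rule topology_inverse')
qed

definition smooth_manifold :: "('a, 'e::euclidean_space) chart set \<Rightarrow> bool" where
  "smooth_manifold A \<longleftrightarrow> smooth_atlas A \<and>
     Hausdorff_space (manifold_topology A) \<and> second_countable (manifold_topology A)"

text \<open>The condition that the preimages are open is the continuity of \<open>f\<close>.\<close>

definition smooth_map ::
  "('a, 'e::euclidean_space) chart set \<Rightarrow> ('b, 'f::euclidean_space) chart set \<Rightarrow> ('a \<Rightarrow> 'b) \<Rightarrow> bool" where
  "smooth_map A B f \<longleftrightarrow> f ` points A \<subseteq> points B \<and>
     (\<forall>\<kappa>\<in>A. \<forall>\<mu>\<in>B. open (snd \<kappa> ` (fst \<kappa> \<inter> f -` fst \<mu>)) \<and>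
        smooth_on (snd \<kappa> ` (fst \<kappa> \<inter> f -` fst \<mu>)) (local_rep \<kappa> \<mu> f))"


section \<open>Tangent vectors and differentials\<close>

text \<open>A tangent vector at \<open>x\<close> is the family of its coordinate vectors with respect to all charts of
  the atlas around \<open>x\<close>; the coordinate vectors are related by the derivatives of the transition
  maps. Entries at all other charts are \<open>0\<close>, so that equality of families is equality of tangent
  vectors. Vector space operations are pointwise.\<close>

type_synonym ('a, 'e) tvec = "('a, 'e) chart \<Rightarrow> 'e"

definition tangent_space :: "('a, 'e::euclidean_space) chart set \<Rightarrow> 'a \<Rightarrow> ('a, 'e) tvec set" where
  "tangent_space A x =
     {\<nu>. (\<forall>\<kappa>. \<kappa> \<notin> A \<or> x \<notin> fst \<kappa> \<longrightarrow> \<nu> \<kappa> = 0) \<and>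
         (\<forall>\<kappa>\<in>A. \<forall>\<mu>\<in>A. x \<in> fst \<kappa> \<inter> fst \<mu> \<longrightarrow>
            \<nu> \<mu> = frechet_derivative (transition \<kappa> \<mu>) (at (snd \<kappa> x)) (\<nu> \<kappa>))}"

text \<open>The tangent vector at \<open>x\<close> whose coordinate vector with respect to \<open>\<kappa>\<close> is \<open>b\<close>.\<close>

definition coord_vec ::
  "('a, 'e::euclidean_space) chart set \<Rightarrow> ('a, 'e) chart \<Rightarrow> 'a \<Rightarrow> 'e \<Rightarrow> ('a, 'e) tvec" where
  "coord_vec A \<kappa> x b = (\<lambda>\<mu>. if \<mu> \<in> A \<and> x \<in> fst \<mu>
     then frechet_derivative (transition \<kappa> \<mu>) (at (snd \<kappa> x)) b else 0)"

text \<open>By the chain rule, the choice of the chart around \<open>p\<close> does not matter.\<close>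

definition differential ::
  "('a, 'e::euclidean_space) chart set \<Rightarrow> ('b, 'f::euclidean_space) chart set \<Rightarrow> ('a \<Rightarrow> 'b) \<Rightarrow> 'a \<Rightarrow>
   ('a, 'e) tvec \<Rightarrow> ('b, 'f) tvec" where
  "differential A B f p \<nu> = (\<lambda>\<mu>. if \<mu> \<in> B \<and> f p \<in> fst \<mu>
     then (let \<kappa> = (SOME \<kappa>. \<kappa> \<in> A \<and> p \<in> fst \<kappa>)
           in frechet_derivative (local_rep \<kappa> \<mu> f) (at (snd \<kappa> p)) (\<nu> \<kappa>))
     else 0)"

definition immersion ::
  "('a, 'e::euclidean_space) chart set \<Rightarrow> ('b, 'f::euclidean_space) chart set \<Rightarrow> ('a \<Rightarrow> 'b) \<Rightarrow> bool" where
  "immersion A B f \<longleftrightarrow> smooth_map A B f \<and>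
     (\<forall>p\<in>points A. inj_on (differential A B f p) (tangent_space A p))"


section \<open>Oriented surfaces\<close>

definition oriented_surface :: "('s, real^2) chart set \<Rightarrow> bool" where
  "oriented_surface B \<longleftrightarrow> smooth_manifold B \<and>
     (\<forall>\<kappa>\<in>B. \<forall>\<mu>\<in>B. \<forall>p\<in>fst \<kappa> \<inter> fst \<mu>.
        det (matrix (frechet_derivative (transition \<kappa> \<mu>) (at (snd \<kappa> p)))) > 0)"

definition oriented_bases ::
  "('s, real^2) chart set \<Rightarrow> 's \<Rightarrow> (('s, real^2) tvec \<times> ('s, real^2) tvec) set" where
  "oriented_bases B p = {(a, b). a \<in> tangent_space B p \<and> b \<in> tangent_space B p \<and>
     (\<forall>\<kappa>\<in>B. p \<in> fst \<kappa> \<longrightarrow> det (vector [a \<kappa>, b \<kappa>] :: real^2^2) > 0)}"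


section \<open>Riemannian metrics and three-forms\<close>

definition linear_on_tangent :: "('a, 'e::euclidean_space) tvec set \<Rightarrow> (('a, 'e) tvec \<Rightarrow> real) \<Rightarrow> bool" where
  "linear_on_tangent V h \<longleftrightarrow>
     (\<forall>u\<in>V. \<forall>v\<in>V. h (\<lambda>\<kappa>. u \<kappa> + v \<kappa>) = h u + h v) \<and>
     (\<forall>r. \<forall>u\<in>V. h (\<lambda>\<kappa>. r *\<^sub>R u \<kappa>) = r * h u)"

type_synonym ('a, 'e) bilinear_field = "'a \<Rightarrow> ('a, 'e) tvec \<Rightarrow> ('a, 'e) tvec \<Rightarrow> real"
type_synonym ('a, 'e) trilinear_field =
  "'a \<Rightarrow> ('a, 'e) tvec \<Rightarrow> ('a, 'e) tvec \<Rightarrow> ('a, 'e) tvec \<Rightarrow> real"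

definition coord_field ::
  "('a, real^'n) chart set \<Rightarrow> ('a, real^'n) chart \<Rightarrow> 'n \<Rightarrow> 'a \<Rightarrow> ('a, real^'n) tvec" where
  "coord_field A \<kappa> i x = coord_vec A \<kappa> x (axis i 1)"

definition metric_coeff ::
  "('a, real^'n) chart set \<Rightarrow> ('a, real^'n) bilinear_field \<Rightarrow> ('a, real^'n) chart \<Rightarrow>
   'n \<Rightarrow> 'n \<Rightarrow> real^'n \<Rightarrow> real" where
  "metric_coeff A g \<kappa> i j y = (let x = inv_into (fst \<kappa>) (snd \<kappa>) y in
     g x (coord_field A \<kappa> i x) (coord_field A \<kappa> j x))"

definition form_coeff ::
  "('a, real^'n) chart set \<Rightarrow> ('a, real^'n) trilinear_field \<Rightarrow> ('a, real^'n) chart \<Rightarrow>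
   'n \<Rightarrow> 'n \<Rightarrow> 'n \<Rightarrow> real^'n \<Rightarrow> real" where
  "form_coeff A \<phi> \<kappa> i j k y = (let x = inv_into (fst \<kappa>) (snd \<kappa>) y in
     \<phi> x (coord_field A \<kappa> i x) (coord_field A \<kappa> j x) (coord_field A \<kappa> k x))"

definition riemannian_metric ::
  "('a, real^'n) chart set \<Rightarrow> ('a, real^'n) bilinear_field \<Rightarrow> bool" where
  "riemannian_metric A g \<longleftrightarrow>
     (\<forall>x\<in>points A. \<forall>u\<in>tangent_space A x.
        linear_on_tangent (tangent_space A x) (g x u) \<and>
        (\<forall>v\<in>tangent_space A x. g x u v = g x v u) \<and>
        (u \<noteq> (\<lambda>\<kappa>. 0) \<longrightarrow> g x u u > 0)) \<and>
     (\<forall>\<kappa>\<in>A. \<forall>i j. smooth_on (snd \<kappa> ` fst \<kappa>) (metric_coeff A g \<kappa> i j))"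

text \<open>Skew symmetry is required for the two adjacent transpositions; with linearity in the last
  argument this gives an alternating trilinear form.\<close>

definition smooth_three_form ::
  "('a, real^'n) chart set \<Rightarrow> ('a, real^'n) trilinear_field \<Rightarrow> bool" where
  "smooth_three_form A \<phi> \<longleftrightarrow>
     (\<forall>x\<in>points A. \<forall>u\<in>tangent_space A x. \<forall>v\<in>tangent_space A x.
        linear_on_tangent (tangent_space A x) (\<phi> x u v) \<and>
        (\<forall>w\<in>tangent_space A x. \<phi> x v u w = - \<phi> x u v w \<and> \<phi> x u w v = - \<phi> x u v w)) \<and>
     (\<forall>\<kappa>\<in>A. \<forall>i j k. smooth_on (snd \<kappa> ` fst \<kappa>) (form_coeff A \<phi> \<kappa> i j k))"

definition partial_deriv :: "'n \<Rightarrow> (real^'n \<Rightarrow> real) \<Rightarrow> real^'n \<Rightarrow> real" where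
  "partial_deriv i h y = frechet_derivative h (at y) (axis i 1)"

text \<open>\<open>christoffel A g \<kappa> k i j\<close> is the coefficient \<open>\<Gamma>\<^sup>k\<^sub>i\<^sub>j\<close> of the Levi-Civita connection of \<open>g\<close> in the
  chart \<open>\<kappa>\<close>, i.e. the covariant derivative of the \<open>j\<close>-th coordinate field in the direction of the
  \<open>i\<close>-th one is the sum over \<open>k\<close> of \<open>\<Gamma>\<^sup>k\<^sub>i\<^sub>j\<close> times the \<open>k\<close>-th one.\<close>

definition christoffel ::
  "('a, real^'n) chart set \<Rightarrow> ('a, real^'n) bilinear_field \<Rightarrow> ('a, real^'n) chart \<Rightarrow>
   'n \<Rightarrow> 'n \<Rightarrow> 'n \<Rightarrow> real^'n \<Rightarrow> real" where
  "christoffel A g \<kappa> k i j y = 1 / 2 * (\<Sum>l\<in>UNIV.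
     matrix_inv (\<chi> a b. metric_coeff A g \<kappa> a b y) $ k $ l *
     (partial_deriv i (metric_coeff A g \<kappa> j l) y +
      partial_deriv j (metric_coeff A g \<kappa> i l) y -
      partial_deriv l (metric_coeff A g \<kappa> i j) y))"

definition covariant_deriv ::
  "('a, real^'n) chart set \<Rightarrow> ('a, real^'n) bilinear_field \<Rightarrow> ('a, real^'n) trilinear_field \<Rightarrow>
   ('a, real^'n) chart \<Rightarrow> 'n \<Rightarrow> 'n \<Rightarrow> 'n \<Rightarrow> 'n \<Rightarrow> real^'n \<Rightarrow> real" where
  "covariant_deriv A g \<phi> \<kappa> l i j k y =
     partial_deriv l (form_coeff A \<phi> \<kappa> i j k) y -
     (\<Sum>m\<in>UNIV. christoffel A g \<kappa> m l i y * form_coeff A \<phi> \<kappa> m j k y +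
                christoffel A g \<kappa> m l j y * form_coeff A \<phi> \<kappa> i m k y +
                christoffel A g \<kappa> m l k y * form_coeff A \<phi> \<kappa> i j m y)"

definition parallel ::
  "('a, real^'n) chart set \<Rightarrow> ('a, real^'n) bilinear_field \<Rightarrow> ('a, real^'n) trilinear_field \<Rightarrow> bool" where
  "parallel A g \<phi> \<longleftrightarrow> (\<forall>\<kappa>\<in>A. \<forall>y\<in>snd \<kappa> ` fst \<kappa>. \<forall>l i j k. covariant_deriv A g \<phi> \<kappa> l i j k y = 0)"


section \<open>Manifolds with holonomy contained in \<open>G\<^sub>2\<close>\<close>

text \<open>Wedge products are normalised by \<open>(\<alpha> \<and> \<beta> \<and> \<gamma>) (e\<^sub>1, e\<^sub>2, e\<^sub>3) = 1\<close> for the frame dual to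
  \<open>\<alpha>, \<beta>, \<gamma>\<close>. In the type \<open>7\<close> the numeral \<open>7\<close> equals \<open>0\<close>, so \<open>1, \<dots>, 7\<close> are its seven elements.\<close>

definition eps :: "7 \<Rightarrow> 7 \<Rightarrow> 7 \<Rightarrow> real^7 \<Rightarrow> real^7 \<Rightarrow> real^7 \<Rightarrow> real" where
  "eps i j k u v w = det (vector [vector [u$i, u$j, u$k],
                                  vector [v$i, v$j, v$k],
                                  vector [w$i, w$j, w$k]] :: real^3^3)"

definition phi0 :: "real^7 \<Rightarrow> real^7 \<Rightarrow> real^7 \<Rightarrow> real" where
  "phi0 u v w = eps 1 2 3 u v w
     + (eps 1 4 5 u v w - eps 1 6 7 u v w)
     + (eps 2 4 6 u v w - eps 2 7 5 u v w)
     + (eps 3 4 7 u v w - eps 3 5 6 u v w)"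

definition frame_comb :: "(7 \<Rightarrow> ('a, real^7) tvec) \<Rightarrow> real^7 \<Rightarrow> ('a, real^7) tvec" where
  "frame_comb e a = (\<lambda>\<kappa>. \<Sum>i\<in>UNIV. (a $ i) *\<^sub>R e i \<kappa>)"

text \<open>A basis of the tangent space at \<open>x\<close> in whose dual coframe \<open>\<phi>\<close> has the form \<open>phi0\<close>.\<close>

definition g2_frame ::
  "('a, real^7) chart set \<Rightarrow> ('a, real^7) trilinear_field \<Rightarrow> 'a \<Rightarrow> (7 \<Rightarrow> ('a, real^7) tvec) \<Rightarrow> bool" where
  "g2_frame A \<phi> x e \<longleftrightarrow>
     (\<forall>i. e i \<in> tangent_space A x) \<and>
     (\<forall>u\<in>tangent_space A x. \<exists>!a. u = frame_comb e a) \<and>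
     (\<forall>a b c. \<phi> x (frame_comb e a) (frame_comb e b) (frame_comb e c) = phi0 a b c)"

definition g2_manifold ::
  "('a, real^7) chart set \<Rightarrow> ('a, real^7) trilinear_field \<Rightarrow> ('a, real^7) bilinear_field \<Rightarrow> bool" where
  "g2_manifold A \<phi> g \<longleftrightarrow> smooth_manifold A \<and> riemannian_metric A g \<and> smooth_three_form A \<phi> \<and>
     (\<forall>x\<in>points A. \<exists>e. g2_frame A \<phi> x e) \<and>
     (\<forall>x\<in>points A. \<forall>e. g2_frame A \<phi> x e \<longrightarrow>
        (\<forall>i j. g x (e i) (e j) = (if i = j then 1 else 0))) \<and>
     parallel A g \<phi>"

definition cross_product ::
  "('a, real^7) chart set \<Rightarrow> ('a, real^7) trilinear_field \<Rightarrow> ('a, real^7) bilinear_field \<Rightarrow>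
   'a \<Rightarrow> ('a, real^7) tvec \<Rightarrow> ('a, real^7) tvec \<Rightarrow> ('a, real^7) tvec" where
  "cross_product A \<phi> g x v w =
     (THE z. z \<in> tangent_space A x \<and> (\<forall>u\<in>tangent_space A x. g x u z = \<phi> x u v w))"

text \<open>An oriented 2-plane \<open>\<xi>\<close> in a tangent space is represented by the set of its oriented bases.\<close>

definition plane_normal ::
  "('a, real^7) chart set \<Rightarrow> ('a, real^7) trilinear_field \<Rightarrow> ('a, real^7) bilinear_field \<Rightarrow>
   'a \<Rightarrow> (('a, real^7) tvec \<times> ('a, real^7) tvec) set \<Rightarrow> ('a, real^7) tvec" where
  "plane_normal A \<phi> g x \<xi> =
     (THE \<eta>. \<exists>u v. (u, v) \<in> \<xi> \<and> g x u u = 1 \<and> g x v v = 1 \<and> g x u v = 0 \<and>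
        \<eta> = cross_product A \<phi> g x u v)"


section \<open>The unit sphere bundle and the Gauss lift\<close>

text \<open>Points of the sphere bundle are pairs of a point and a unit tangent vector there. Its smooth
  structure is the one inherited from \<open>TX\<close>, described by central projection: for a linear
  isomorphism \<open>\<Phi>\<close> from \<open>\<real>\<^sup>7\<close> to \<open>\<real> \<times> \<real>\<^sup>6\<close>, the part of the sphere in the half space where the first
  component of \<open>\<Phi>\<close> is positive is projected from the origin onto the affine hyperplane where that
  component is \<open>1\<close>. The inverse is \<open>(y, t) \<mapsto> \<Phi>\<inverse> (1, t) / |\<Phi>\<inverse> (1, t)|\<close> at the point with coordinates
  \<open>y\<close>, with the norm of \<open>g\<close>, which is smooth as a map to \<open>TX\<close>.\<close>

definition sphere_chart ::
  "('a, real^7) chart set \<Rightarrow> ('a, real^7) bilinear_field \<Rightarrow> ('a, real^7) chart \<Rightarrow>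
   (real^7 \<Rightarrow> real \<times> (real^6)) \<Rightarrow> ('a \<times> ('a, real^7) tvec, (real^7) \<times> (real^6)) chart" where
  "sphere_chart A g \<kappa> \<Phi> =
     ({(x, \<nu>). x \<in> fst \<kappa> \<and> \<nu> \<in> tangent_space A x \<and> g x \<nu> \<nu> = 1 \<and> fst (\<Phi> (\<nu> \<kappa>)) > 0},
      \<lambda>(x, \<nu>). (snd \<kappa> x, (1 / fst (\<Phi> (\<nu> \<kappa>))) *\<^sub>R snd (\<Phi> (\<nu> \<kappa>))))"

definition sphere_bundle ::
  "('a, real^7) chart set \<Rightarrow> ('a, real^7) bilinear_field \<Rightarrow>
   ('a \<times> ('a, real^7) tvec, (real^7) \<times> (real^6)) chart set" where
  "sphere_bundle A g = {sphere_chart A g \<kappa> \<Phi> | \<kappa> \<Phi>. \<kappa> \<in> A \<and> linear \<Phi> \<and> bij \<Phi>}"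

abbreviation bundle_proj :: "'a \<times> ('a, real^7) tvec \<Rightarrow> 'a" where
  "bundle_proj \<equiv> fst"

definition orthogonal_complement ::
  "('a, real^7) chart set \<Rightarrow> ('a, real^7) bilinear_field \<Rightarrow> 'a \<times> ('a, real^7) tvec \<Rightarrow>
   ('a, real^7) tvec set" where
  "orthogonal_complement A g \<eta> =
     {w \<in> tangent_space A (bundle_proj \<eta>). g (bundle_proj \<eta>) w (snd \<eta>) = 0}"

definition canonical_distribution ::
  "('a, real^7) chart set \<Rightarrow> ('a, real^7) bilinear_field \<Rightarrow> 'a \<times> ('a, real^7) tvec \<Rightarrow>
   ('a \<times> ('a, real^7) tvec, (real^7) \<times> (real^6)) tvec set" where
  "canonical_distribution A g \<eta> =
     {w \<in> tangent_space (sphere_bundle A g) \<eta>.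
        differential (sphere_bundle A g) A bundle_proj \<eta> w \<in> orthogonal_complement A g \<eta>}"

definition gauss_lift ::
  "('s, real^2) chart set \<Rightarrow> ('a, real^7) chart set \<Rightarrow> ('a, real^7) trilinear_field \<Rightarrow>
   ('a, real^7) bilinear_field \<Rightarrow> ('s \<Rightarrow> 'a) \<Rightarrow> 's \<Rightarrow> 'a \<times> ('a, real^7) tvec" where
  "gauss_lift B A \<phi> g f p =
     (f p, plane_normal A \<phi> g (f p)
       ((\<lambda>(a, b). (differential B A f p a, differential B A f p b)) ` oriented_bases B p))"

end

theory Submission
  imports Defs
begin

text \<open>
  Let \<open>F\<close> be the Gauss lift and \<open>\<pi>\<close> the projection of the sphere bundle. Since \<open>\<pi> \<circ> F = f\<close>, the chain rule
  gives \<open>\<pi>\<^sub>* \<circ> F\<^sub>* = f\<^sub>*\<close>. As \<open>f\<^sub>*\<close> is injective, so is \<open>F\<^sub>*\<close>. The lift at \<open>p\<close> is a multiple of \<open>U \<times> V\<close> for a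
  basis \<open>U, V\<close> of \<open>f\<^sub>*(T\<^sub>p\<Sigma>)\<close>, and \<open>g (w, U \<times> V) = \<phi> (w, U, V)\<close> vanishes for \<open>w\<close> in the span of \<open>U\<close> and \<open>V\<close>
  because \<open>\<phi>\<close> is alternating. Hence \<open>\<pi>\<^sub>* (F\<^sub>* a) = f\<^sub>* a\<close> is orthogonal to the lift, which says that \<open>F\<^sub>* a\<close>
  lies in the canonical distribution.

  The work lies in what this argument presupposes. The charts of the sphere bundle
  must form a smooth atlas, so that differentials are functorial (\<open>smooth_atlas_sphere_bundle\<close>,
  \<open>differential_compose\<close>), and the lift must be well defined with unit values (\<open>plane_normal_vec\<close>) and
  smooth (\<open>smooth_map_gauss_lift\<close>).

  Within a plane, the cross product of two vectors depends only on the determinant of their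
  coefficients, and for an oriented orthonormal basis this determinant is one over the area spanned
  by \<open>U\<close> and \<open>V\<close>. So the lift is well defined. It has unit length because a \<open>G\<^sub>2\<close>-frame transports the
  cross product of \<open>\<real>\<^sup>7\<close>, for which \<open>|u \<times> v|\<^sup>2 = |u|\<^sup>2 |v|\<^sup>2 - (u \<bullet> v)\<^sup>2\<close>, to the tangent space.

  Smoothness rests on the observation that the fibre coordinates of the sphere bundle are
  central projections, which ignore positive factors. The normalising factors, the only place
  where square roots occur, thus cancel from all coordinate expressions. The transition maps of the
  sphere bundle involve the derivative of those of the base and no metric, and the lift is
  represented by the central projection of \<open>U \<times> V\<close>, which solves a linear system with smooth
  coefficients.
\<close>

section \<open>Calculus of smooth maps\<close>

lemma Ck_on_cong:
  assumes "open S" "\<And>x. x \<in> S \<Longrightarrow> f x = h x" "Ck_on k S f"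
  shows "Ck_on k S h"
  using assms(2,3)
proof (induction k arbitrary: f h)
  case 0
  then show ?case by (simp cong: continuous_on_cong)
next
  case (Suc k)
  have D: "(h has_derivative frechet_derivative f (at x)) (at x)" if "x \<in> S" for x
  proof -
    have "(f has_derivative frechet_derivative f (at x)) (at x)"
      using Suc.prems(2) that by (simp add: frechet_derivative_works)
    then show ?thesis
      using assms(1) that Suc.prems(1) by (rule has_derivative_transform_within_open)
  qed
  have "Ck_on k S (\<lambda>x. frechet_derivative h (at x) v)" for v
  proof (rule Suc.IH)
    show "Ck_on k S (\<lambda>x. frechet_derivative f (at x) v)" using Suc.prems by simp
  qed (use frechet_derivative_at[OF D] in auto)
  then show ?case using D unfolding Ck_on.simps differentiable_def by blast
qed

lemma Ck_on_SucI:
  assumes "open S" "\<And>x. x \<in> S \<Longrightarrow> (f has_derivative f' x) (at x)"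
    and "\<And>v. Ck_on k S (\<lambda>x. f' x v)"
  shows "Ck_on (Suc k) S f"
proof -
  have "Ck_on k S (\<lambda>x. frechet_derivative f (at x) v)" for v
    using assms(1) _ assms(3)[of v]
    by (rule Ck_on_cong) (use frechet_derivative_at[OF assms(2)] in auto)
  then show ?thesis using assms(2) unfolding Ck_on.simps differentiable_def by blast
qed

lemma Ck_on_has_derivative:
  "Ck_on (Suc k) S f \<Longrightarrow> x \<in> S \<Longrightarrow> (f has_derivative frechet_derivative f (at x)) (at x)"
  by (simp add: frechet_derivative_works)

lemma Ck_on_lower: "Ck_on (Suc k) S f \<Longrightarrow> Ck_on k S f"
proof (induction k arbitrary: f)
  case 0
  then have "f differentiable_on S"
    unfolding differentiable_on_def Ck_on.simps by (blast intro: differentiable_at_withinI)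
  then show ?case by (simp add: differentiable_imp_continuous_on)
next
  case (Suc k)
  from Suc.prems have d: "\<forall>x\<in>S. f differentiable at x"
    and "\<forall>v. Ck_on (Suc k) S (\<lambda>x. frechet_derivative f (at x) v)"
    unfolding Ck_on.simps(2)[of "Suc k"] by blast+
  then have "\<forall>v. Ck_on k S (\<lambda>x. frechet_derivative f (at x) v)" using Suc.IH by blast
  with d show ?case by simp
qed

lemma Ck_on_subset: "Ck_on k T f \<Longrightarrow> S \<subseteq> T \<Longrightarrow> Ck_on k S f"
  by (induction k arbitrary: f) (auto intro: continuous_on_subset)

lemma Ck_on_const: "open S \<Longrightarrow> Ck_on k S (\<lambda>_. c)"
proof (induction k arbitrary: c)
  case (Suc k)
  then show ?case by (intro Ck_on_SucI[where f' = "\<lambda>_ _. 0"]) auto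
qed simp

lemma Ck_on_ident: "open S \<Longrightarrow> Ck_on k S (\<lambda>x. x)"
  by (cases k) (auto intro!: Ck_on_SucI[where f' = "\<lambda>_ v. v"] Ck_on_const)

lemma Ck_on_bounded_linear:
  assumes "bounded_linear L" "open S" "Ck_on k S f"
  shows "Ck_on k S (\<lambda>x. L (f x))"
  using assms(3)
proof (induction k arbitrary: f)
  case 0
  then show ?case using bounded_linear.continuous_on[OF assms(1)] by auto
next
  case (Suc k)
  show ?case
  proof (rule Ck_on_SucI[OF \<open>open S\<close>])
    show "((\<lambda>x. L (f x)) has_derivative (\<lambda>v. L (frechet_derivative f (at x) v))) (at x)"
      if "x \<in> S" for x
      by (rule bounded_linear.has_derivative[OF assms(1) Ck_on_has_derivative[OF Suc.prems that]])
    show "Ck_on k S (\<lambda>x. L (frechet_derivative f (at x) v))" for v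
      using Suc by simp
  qed
qed

lemma Ck_on_add:
  assumes "open S" "Ck_on k S f" "Ck_on k S h"
  shows "Ck_on k S (\<lambda>x. f x + h x)"
  using assms(2,3)
proof (induction k arbitrary: f h)
  case 0
  then show ?case by (simp add: continuous_on_add)
next
  case (Suc k)
  show ?case
  proof (rule Ck_on_SucI[OF \<open>open S\<close> has_derivative_add
        [OF Ck_on_has_derivative[OF Suc.prems(1)] Ck_on_has_derivative[OF Suc.prems(2)]]])
    show "Ck_on k S (\<lambda>x. frechet_derivative f (at x) v + frechet_derivative h (at x) v)" for v
      by (rule Suc.IH) (use Suc.prems in simp_all)
  qed
qed

lemma Ck_on_bounded_bilinear:
  assumes "bounded_bilinear b" "open S" "Ck_on k S f" "Ck_on k S h"
  shows "Ck_on k S (\<lambda>x. b (f x) (h x))"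
  using assms(3,4)
proof (induction k arbitrary: f h)
  case 0
  then show ?case by (simp add: bounded_bilinear.continuous_on[OF assms(1)])
next
  case (Suc k)
  show ?case
  proof (rule Ck_on_SucI[OF \<open>open S\<close> bounded_bilinear.FDERIV[OF assms(1)
          Ck_on_has_derivative[OF Suc.prems(1)] Ck_on_has_derivative[OF Suc.prems(2)]]])
    fix v
    have f: "Ck_on k S f" and h: "Ck_on k S h"
      by (rule Ck_on_lower[OF Suc.prems(1)], rule Ck_on_lower[OF Suc.prems(2)])
    have df: "Ck_on k S (\<lambda>x. frechet_derivative f (at x) v)"
      and dh: "Ck_on k S (\<lambda>x. frechet_derivative h (at x) v)"
      using Suc.prems by simp_all
    show "Ck_on k S (\<lambda>x. b (f x) (frechet_derivative h (at x) v) + b (frechet_derivative f (at x) v) (h x))"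
      by (rule Ck_on_add[OF \<open>open S\<close> Suc.IH[OF f dh] Suc.IH[OF df h]])
  qed
qed

lemma Ck_on_sum:
  assumes "open S" "\<And>i. i \<in> I \<Longrightarrow> Ck_on k S (f i)"
  shows "Ck_on k S (\<lambda>x. \<Sum>i\<in>I. f i x)"
  using assms(2)
  by (induction I rule: infinite_finite_induct)
    (simp_all add: Ck_on_const[OF assms(1)] Ck_on_add[OF assms(1)])

lemma Ck_on_inverse:
  fixes f :: "'a::real_normed_vector \<Rightarrow> real"
  assumes "open S" "Ck_on k S f" "\<And>x. x \<in> S \<Longrightarrow> f x \<noteq> 0"
  shows "Ck_on k S (\<lambda>x. inverse (f x))"
  using assms(2)
proof (induction k)
  case 0
  then show ?case using assms(3) by (simp add: continuous_on_inverse)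
next
  case (Suc k)
  note mult = Ck_on_bounded_bilinear[OF bounded_bilinear_mult \<open>open S\<close>]
  show ?case
  proof (rule Ck_on_SucI[OF \<open>open S\<close>])
    show "((\<lambda>x. inverse (f x)) has_derivative
        (\<lambda>v. - (inverse (f x) * frechet_derivative f (at x) v * inverse (f x)))) (at x)"
      if "x \<in> S" for x
      by (rule Deriv.has_derivative_inverse[OF assms(3)[OF that] Ck_on_has_derivative[OF Suc.prems that]])
    fix v
    have "Ck_on k S (\<lambda>x. inverse (f x))" "Ck_on k S (\<lambda>x. frechet_derivative f (at x) v)"
      using Suc.IH Ck_on_lower[OF Suc.prems] Suc.prems by auto
    then have "Ck_on k S (\<lambda>x. inverse (f x) * frechet_derivative f (at x) v * inverse (f x))"
      by (intro mult)
    then show "Ck_on k S (\<lambda>x. - (inverse (f x) * frechet_derivative f (at x) v * inverse (f x)))"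
      by (rule Ck_on_bounded_linear[OF bounded_linear_minus[OF bounded_linear_ident] \<open>open S\<close>])
  qed
qed

text \<open>The derivative of \<open>h \<circ> f\<close> in the direction \<open>v\<close> is expanded in a basis of the middle space,
  so that only derivatives of \<open>h\<close> in constant directions occur and the induction goes through.\<close>

lemma Ck_on_compose:
  fixes f :: "'a::real_normed_vector \<Rightarrow> 'b::euclidean_space"
    and h :: "'b \<Rightarrow> 'c::real_normed_vector"
  assumes "open S" "f ` S \<subseteq> T" "Ck_on k S f" "Ck_on k T h"
  shows "Ck_on k S (\<lambda>x. h (f x))"
  using assms(3,4)
proof (induction k arbitrary: h)
  case 0
  then show ?case using assms(2) by (auto intro: continuous_on_compose2)
next
  case (Suc k)
  let ?f' = "\<lambda>x. frechet_derivative f (at x)" and ?h' = "\<lambda>y. frechet_derivative h (at y)"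
  show ?case
  proof (rule Ck_on_SucI[OF \<open>open S\<close>])
    show "((\<lambda>x. h (f x)) has_derivative (\<lambda>v. \<Sum>b\<in>Basis. (?f' x v \<bullet> b) *\<^sub>R ?h' (f x) b)) (at x)"
      if "x \<in> S" for x
    proof -
      have fx: "f x \<in> T" using assms(2) that by blast
      have h': "(h has_derivative ?h' (f x)) (at (f x))"
        by (rule Ck_on_has_derivative[OF Suc.prems(2) fx])
      then have lin: "linear (?h' (f x))" by (rule has_derivative_linear)
      have "(\<Sum>b\<in>Basis. (?f' x v \<bullet> b) *\<^sub>R ?h' (f x) b) = ?h' (f x) (?f' x v)" for v
      proof -
        have "?h' (f x) (?f' x v) = ?h' (f x) (\<Sum>b\<in>Basis. (?f' x v \<bullet> b) *\<^sub>R b)"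
          by (simp only: euclidean_representation)
        then show ?thesis by (simp add: linear_sum[OF lin] linear_scale[OF lin])
      qed
      then show ?thesis
        using has_derivative_compose[OF Ck_on_has_derivative[OF Suc.prems(1) that] h'] by simp
    qed
    fix v
    have "Ck_on k S (\<lambda>x. (?f' x v \<bullet> b) *\<^sub>R ?h' (f x) b)" for b
    proof (rule Ck_on_bounded_bilinear[OF bounded_bilinear_scaleR \<open>open S\<close>])
      show "Ck_on k S (\<lambda>x. ?f' x v \<bullet> b)"
        by (rule Ck_on_bounded_linear[OF bounded_linear_inner_left \<open>open S\<close>])
          (use Suc.prems in simp)
      show "Ck_on k S (\<lambda>x. ?h' (f x) b)"
        using Suc.IH[OF Ck_on_lower[OF Suc.prems(1)], of "\<lambda>y. ?h' y b"] Suc.prems by simp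
    qed
    then show "Ck_on k S (\<lambda>x. \<Sum>b\<in>Basis. (?f' x v \<bullet> b) *\<^sub>R ?h' (f x) b)"
      by (intro Ck_on_sum[OF \<open>open S\<close>])
  qed
qed

lemma smooth_on_cong:
  "smooth_on S f \<Longrightarrow> open S \<Longrightarrow> (\<And>x. x \<in> S \<Longrightarrow> f x = h x) \<Longrightarrow> smooth_on S h"
  using Ck_on_cong unfolding smooth_on_def by blast

lemma smooth_on_subset: "smooth_on T f \<Longrightarrow> S \<subseteq> T \<Longrightarrow> smooth_on S f"
  using Ck_on_subset unfolding smooth_on_def by blast

lemma smooth_on_continuous: "smooth_on S f \<Longrightarrow> continuous_on S f"
  unfolding smooth_on_def by (metis Ck_on.simps(1))

lemma smooth_on_has_derivative:
  "smooth_on S f \<Longrightarrow> x \<in> S \<Longrightarrow> (f has_derivative frechet_derivative f (at x)) (at x)"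
  using Ck_on_has_derivative unfolding smooth_on_def by blast

lemma smooth_on_frechet_derivative:
  "smooth_on S f \<Longrightarrow> smooth_on S (\<lambda>x. frechet_derivative f (at x) v)"
  unfolding smooth_on_def using Ck_on.simps(2) by blast

lemma smooth_on_const: "open S \<Longrightarrow> smooth_on S (\<lambda>_. c)"
  by (simp add: smooth_on_def Ck_on_const)

lemma smooth_on_ident: "open S \<Longrightarrow> smooth_on S (\<lambda>x. x)"
  by (simp add: smooth_on_def Ck_on_ident)

lemma smooth_on_linear:
  fixes L :: "'b::euclidean_space \<Rightarrow> 'c::real_normed_vector"
  shows "linear L \<Longrightarrow> open S \<Longrightarrow> smooth_on S f \<Longrightarrow> smooth_on S (\<lambda>x. L (f x))"
  by (simp add: smooth_on_def Ck_on_bounded_linear linear_conv_bounded_linear)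

lemma smooth_on_add:
  "open S \<Longrightarrow> smooth_on S f \<Longrightarrow> smooth_on S h \<Longrightarrow> smooth_on S (\<lambda>x. f x + h x)"
  by (simp add: smooth_on_def Ck_on_add)

lemma smooth_on_scaleR:
  "open S \<Longrightarrow> smooth_on S f \<Longrightarrow> smooth_on S h \<Longrightarrow> smooth_on S (\<lambda>x. f x *\<^sub>R h x)"
  by (simp add: smooth_on_def Ck_on_bounded_bilinear[OF bounded_bilinear_scaleR])

lemma smooth_on_mult:
  fixes f h :: "'a::real_normed_vector \<Rightarrow> real"
  shows "open S \<Longrightarrow> smooth_on S f \<Longrightarrow> smooth_on S h \<Longrightarrow> smooth_on S (\<lambda>x. f x * h x)"
  using smooth_on_scaleR[of S f h] by simp

lemma smooth_on_sum:
  "open S \<Longrightarrow> (\<And>i. i \<in> I \<Longrightarrow> smooth_on S (f i)) \<Longrightarrow> smooth_on S (\<lambda>x. \<Sum>i\<in>I. f i x)"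
  by (simp add: smooth_on_def Ck_on_sum)

lemma smooth_on_prod:
  fixes f :: "'i \<Rightarrow> 'a::real_normed_vector \<Rightarrow> real"
  assumes "open S" "\<And>i. i \<in> I \<Longrightarrow> smooth_on S (f i)"
  shows "smooth_on S (\<lambda>x. \<Prod>i\<in>I. f i x)"
  using assms(2)
  by (induction I rule: infinite_finite_induct)
    (simp_all add: smooth_on_const[OF assms(1)] smooth_on_mult[OF assms(1)])

lemma smooth_on_divide:
  fixes f h :: "'a::real_normed_vector \<Rightarrow> real"
  assumes "open S" "smooth_on S f" "smooth_on S h" "\<And>x. x \<in> S \<Longrightarrow> h x \<noteq> 0"
  shows "smooth_on S (\<lambda>x. f x / h x)"
proof -
  have "smooth_on S (\<lambda>x. inverse (h x))"
    using assms unfolding smooth_on_def by (blast intro: Ck_on_inverse)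
  then show ?thesis
    using smooth_on_mult[OF assms(1,2)] by (simp add: divide_inverse)
qed

lemma smooth_on_compose:
  fixes f :: "'a::real_normed_vector \<Rightarrow> 'b::euclidean_space"
  shows "open S \<Longrightarrow> smooth_on S f \<Longrightarrow> smooth_on T h \<Longrightarrow> f ` S \<subseteq> T \<Longrightarrow> smooth_on S (\<lambda>x. h (f x))"
  by (simp add: smooth_on_def Ck_on_compose)

lemma smooth_on_Pair:
  fixes f :: "'a::real_normed_vector \<Rightarrow> 'b::euclidean_space" and h :: "'a \<Rightarrow> 'c::euclidean_space"
  assumes "open S" "smooth_on S f" "smooth_on S h"
  shows "smooth_on S (\<lambda>x. (f x, h x))"
proof -
  have "linear (\<lambda>y. (y, 0 :: 'c))" "linear (\<lambda>z. (0 :: 'b, z))"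
    by (auto intro!: linearI)
  from smooth_on_add[OF assms(1) smooth_on_linear[OF this(1) assms(1,2)]
      smooth_on_linear[OF this(2) assms(1,3)]]
  show ?thesis by simp
qed

lemma smooth_on_vec:
  fixes f :: "'n::finite \<Rightarrow> 'a::real_normed_vector \<Rightarrow> real"
  assumes "open S" "\<And>i. smooth_on S (f i)"
  shows "smooth_on S (\<lambda>x. \<chi> i. f i x)"
proof -
  have "smooth_on S (\<lambda>x. \<Sum>i\<in>UNIV. f i x *\<^sub>R (axis i 1 :: real^'n))"
    by (intro smooth_on_sum smooth_on_scaleR smooth_on_const assms)
  moreover have "(\<Sum>i\<in>UNIV. f i x *\<^sub>R (axis i 1 :: real^'n)) = (\<chi> i. f i x)" for x
    using basis_expansion[of "\<chi> i. f i x"] by (simp add: scalar_mult_eq_scaleR)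
  ultimately show ?thesis by simp
qed

lemma smooth_on_nth: "open S \<Longrightarrow> smooth_on S f \<Longrightarrow> smooth_on S (\<lambda>x. (f x :: real^'n) $ i)"
  by (rule smooth_on_linear[of "\<lambda>y. y $ i"]) (auto intro!: linearI)

lemma smooth_on_det:
  fixes M :: "'a::real_normed_vector \<Rightarrow> real^'n^'n"
  assumes "open S" "\<And>i j. smooth_on S (\<lambda>x. M x $ i $ j)"
  shows "smooth_on S (\<lambda>x. det (M x))"
  unfolding det_def by (intro smooth_on_sum smooth_on_mult smooth_on_prod smooth_on_const assms)

text \<open>Cramer's rule expresses the solution of a linear system through determinants, hence
  rationally in the coefficients.\<close>

lemma smooth_on_linear_solve:
  fixes M :: "'a::real_normed_vector \<Rightarrow> real^'n^'n"
  assumes S: "open S" and M: "\<And>i j. smooth_on S (\<lambda>x. M x $ i $ j)"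
    and b: "\<And>i. smooth_on S (\<lambda>x. b x $ i)"
    and det: "\<And>x. x \<in> S \<Longrightarrow> det (M x) \<noteq> 0"
    and z: "\<And>x. x \<in> S \<Longrightarrow> M x *v z x = b x"
  shows "smooth_on S z"
proof (rule smooth_on_cong[OF _ S])
  show "smooth_on S (\<lambda>x. \<chi> k. det (\<chi> i j. if j = k then b x $ i else M x $ i $ j) / det (M x))"
  proof (intro smooth_on_vec smooth_on_divide smooth_on_det S M det)
    show "smooth_on S (\<lambda>x. (\<chi> i j. if j = k then b x $ i else M x $ i $ j) $ i $ j)" for i j k
      by (cases "j = k") (simp_all add: M b)
  qed
  show "(\<chi> k. det (\<chi> i j. if j = k then b x $ i else M x $ i $ j) / det (M x)) = z x"
    if "x \<in> S" for x
    using iffD1[OF cramer[OF det[OF that]] z[OF that]] by (rule sym)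
qed

lemma open_positive:
  fixes h :: "'a::topological_space \<Rightarrow> real"
  assumes "open S" "continuous_on S h"
  shows "open {x \<in> S. 0 < h x}"
proof -
  have "open (S \<inter> h -` {0<..})"
    by (rule continuous_open_preimage[OF assms(2,1) open_greaterThan])
  moreover have "S \<inter> h -` {0<..} = {x \<in> S. 0 < h x}" by auto
  ultimately show ?thesis by simp
qed

section \<open>Differentials of smooth maps\<close>

lemma local_rep_at:
  "inj_on (snd \<kappa>) (fst \<kappa>) \<Longrightarrow> p \<in> fst \<kappa> \<Longrightarrow> local_rep \<kappa> \<mu> f (snd \<kappa> p) = snd \<mu> (f p)"
  by (simp add: local_rep_def inv_into_f_f)

lemma smooth_atlas_inj: "smooth_atlas A \<Longrightarrow> \<kappa> \<in> A \<Longrightarrow> inj_on (snd \<kappa>) (fst \<kappa>)"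
  unfolding smooth_atlas_def by blast

lemma smooth_map_ident: "smooth_atlas A \<Longrightarrow> smooth_map A A (\<lambda>x. x)"
  unfolding smooth_atlas_def smooth_map_def by simp

lemma smooth_map_has_derivative:
  assumes "smooth_map A B f" "\<kappa> \<in> A" "\<mu> \<in> B" "p \<in> fst \<kappa>" "f p \<in> fst \<mu>"
  shows "(local_rep \<kappa> \<mu> f has_derivative frechet_derivative (local_rep \<kappa> \<mu> f) (at (snd \<kappa> p)))
    (at (snd \<kappa> p))"
proof (rule smooth_on_has_derivative)
  show "smooth_on (snd \<kappa> ` (fst \<kappa> \<inter> f -` fst \<mu>)) (local_rep \<kappa> \<mu> f)"
    using assms unfolding smooth_map_def by blast
qed (use assms in auto)

text \<open>The source of all functoriality: near \<open>snd \<kappa> p\<close> the local representation of \<open>h \<circ> f\<close> factors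
  through any chart around \<open>f p\<close>. Taking \<open>f\<close> or \<open>h\<close> to be the identity gives the independence of
  differentials of the charts.\<close>

lemma local_rep_chain:
  assumes A: "smooth_atlas A" and B: "smooth_atlas B"
    and f: "smooth_map A B f" and h: "smooth_map B C h"
    and \<kappa>: "\<kappa> \<in> A" "p \<in> fst \<kappa>" and \<mu>: "\<mu> \<in> B" "f p \<in> fst \<mu>" and \<nu>: "\<nu> \<in> C" "h (f p) \<in> fst \<nu>"
  shows "frechet_derivative (local_rep \<kappa> \<nu> (\<lambda>x. h (f x))) (at (snd \<kappa> p)) v =
    frechet_derivative (local_rep \<mu> \<nu> h) (at (snd \<mu> (f p)))
      (frechet_derivative (local_rep \<kappa> \<mu> f) (at (snd \<kappa> p)) v)"
proof -
  let ?U = "snd \<kappa> ` (fst \<kappa> \<inter> f -` fst \<mu>)"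
  have "open ?U" using f \<kappa> \<mu> unfolding smooth_map_def by blast
  have eq: "local_rep \<kappa> \<mu> f (snd \<kappa> p) = snd \<mu> (f p)"
    using smooth_atlas_inj[OF A \<kappa>(1)] \<kappa>(2) by (rule local_rep_at)
  have drv: "((\<lambda>y. local_rep \<mu> \<nu> h (local_rep \<kappa> \<mu> f y)) has_derivative
      (\<lambda>v. frechet_derivative (local_rep \<mu> \<nu> h) (at (snd \<mu> (f p)))
      (frechet_derivative (local_rep \<kappa> \<mu> f) (at (snd \<kappa> p)) v))) (at (snd \<kappa> p))"
    by (rule has_derivative_compose[OF smooth_map_has_derivative[OF f \<kappa>(1) \<mu>(1) \<kappa>(2) \<mu>(2)]])
      (use smooth_map_has_derivative[OF h \<mu>(1) \<nu>(1) \<mu>(2) \<nu>(2)] eq in simp)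
  have eqU: "local_rep \<mu> \<nu> h (local_rep \<kappa> \<mu> f y) = local_rep \<kappa> \<nu> (\<lambda>x. h (f x)) y"
    if "y \<in> ?U" for y
    using that smooth_atlas_inj[OF A \<kappa>(1)] smooth_atlas_inj[OF B \<mu>(1)]
    by (auto simp: local_rep_at)
  from drv have "(local_rep \<kappa> \<nu> (\<lambda>x. h (f x)) has_derivative
      (\<lambda>v. frechet_derivative (local_rep \<mu> \<nu> h) (at (snd \<mu> (f p)))
      (frechet_derivative (local_rep \<kappa> \<mu> f) (at (snd \<kappa> p)) v))) (at (snd \<kappa> p))"
    using \<open>open ?U\<close> _ eqU by (rule has_derivative_transform_within_open) (use \<kappa> \<mu> in auto)
  from frechet_derivative_at[OF this] show ?thesis by metis
qed

lemma tangent_space_transition: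
  assumes "\<nu> \<in> tangent_space A x" "\<kappa> \<in> A" "x \<in> fst \<kappa>" "\<mu> \<in> A" "x \<in> fst \<mu>"
  shows "\<nu> \<mu> = frechet_derivative (transition \<kappa> \<mu>) (at (snd \<kappa> x)) (\<nu> \<kappa>)"
  using assms unfolding tangent_space_def by blast

lemma differential_in_chart:
  assumes A: "smooth_atlas A" and f: "smooth_map A B f" and \<nu>: "\<nu> \<in> tangent_space A p"
    and \<kappa>: "\<kappa> \<in> A" "p \<in> fst \<kappa>" and \<mu>: "\<mu> \<in> B" "f p \<in> fst \<mu>"
  shows "differential A B f p \<nu> \<mu> = frechet_derivative (local_rep \<kappa> \<mu> f) (at (snd \<kappa> p)) (\<nu> \<kappa>)"
proof -
  define \<kappa>' where "\<kappa>' = (SOME \<kappa>. \<kappa> \<in> A \<and> p \<in> fst \<kappa>)"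
  have \<kappa>': "\<kappa>' \<in> A \<and> p \<in> fst \<kappa>'"
    unfolding \<kappa>'_def by (rule someI[where x = \<kappa>]) (use \<kappa> in blast)
  have "differential A B f p \<nu> \<mu> =
      frechet_derivative (local_rep \<kappa>' \<mu> f) (at (snd \<kappa>' p)) (\<nu> \<kappa>')"
    using \<mu> unfolding differential_def Let_def \<kappa>'_def by simp
  also have "\<nu> \<kappa>' = frechet_derivative (transition \<kappa> \<kappa>') (at (snd \<kappa> p)) (\<nu> \<kappa>)"
    using tangent_space_transition[OF \<nu> \<kappa>] \<kappa>' by blast
  also have "frechet_derivative (local_rep \<kappa>' \<mu> f) (at (snd \<kappa>' p)) \<dots> =
      frechet_derivative (local_rep \<kappa> \<mu> f) (at (snd \<kappa> p)) (\<nu> \<kappa>)"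
    using local_rep_chain[OF A A smooth_map_ident[OF A] f \<kappa> _ _ \<mu>, of \<kappa>'] \<kappa>' by simp
  finally show ?thesis .
qed

lemma points_chart:
  assumes "p \<in> points A" obtains \<kappa> where "\<kappa> \<in> A" "p \<in> fst \<kappa>"
  using assms unfolding points_def by blast

lemma differential_tangent:
  assumes A: "smooth_atlas A" and B: "smooth_atlas B" and f: "smooth_map A B f"
    and p: "p \<in> points A" and \<nu>: "\<nu> \<in> tangent_space A p"
  shows "differential A B f p \<nu> \<in> tangent_space B (f p)"
  unfolding tangent_space_def
proof (intro CollectI conjI allI impI ballI)
  show "differential A B f p \<nu> \<mu> = 0" if "\<mu> \<notin> B \<or> f p \<notin> fst \<mu>" for \<mu>
    using that unfolding differential_def by auto
  fix \<mu> \<mu>' assume "\<mu> \<in> B" "\<mu>' \<in> B" and fp: "f p \<in> fst \<mu> \<inter> fst \<mu>'"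
  obtain \<kappa> where \<kappa>: "\<kappa> \<in> A" "p \<in> fst \<kappa>" using p by (rule points_chart)
  show "differential A B f p \<nu> \<mu>' =
      frechet_derivative (transition \<mu> \<mu>') (at (snd \<mu> (f p))) (differential A B f p \<nu> \<mu>)"
    using local_rep_chain[OF A B f smooth_map_ident[OF B] \<kappa> \<open>\<mu> \<in> B\<close> _ \<open>\<mu>' \<in> B\<close>, of "\<nu> \<kappa>"] fp
      differential_in_chart[OF A f \<nu> \<kappa>] \<open>\<mu> \<in> B\<close> \<open>\<mu>' \<in> B\<close> by simp
qed

lemma differential_compose:
  assumes A: "smooth_atlas A" and B: "smooth_atlas B"
    and f: "smooth_map A B f" and h: "smooth_map B C h"
    and p: "p \<in> points A" and \<nu>: "\<nu> \<in> tangent_space A p"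
  shows "differential B C h (f p) (differential A B f p \<nu>) = differential A C (\<lambda>x. h (f x)) p \<nu>"
proof
  fix \<tau>
  obtain \<kappa> where \<kappa>: "\<kappa> \<in> A" "p \<in> fst \<kappa>" using p by (rule points_chart)
  have "f p \<in> points B" using f p unfolding smooth_map_def by blast
  then obtain \<mu> where \<mu>: "\<mu> \<in> B" "f p \<in> fst \<mu>" by (rule points_chart)
  define \<kappa>' where "\<kappa>' = (SOME \<kappa>. \<kappa> \<in> A \<and> p \<in> fst \<kappa>)"
  have \<kappa>': "\<kappa>' \<in> A" "p \<in> fst \<kappa>'"
    using someI[of "\<lambda>\<kappa>. \<kappa> \<in> A \<and> p \<in> fst \<kappa>", OF conjI[OF \<kappa>]] unfolding \<kappa>'_def by auto
  show "differential B C h (f p) (differential A B f p \<nu>) \<tau> = differential A C (\<lambda>x. h (f x)) p \<nu> \<tau>"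
  proof (cases "\<tau> \<in> C \<and> h (f p) \<in> fst \<tau>")
    case True
    have "differential B C h (f p) (differential A B f p \<nu>) \<tau> =
        frechet_derivative (local_rep \<mu> \<tau> h) (at (snd \<mu> (f p))) (differential A B f p \<nu> \<mu>)"
      using differential_in_chart[OF B h differential_tangent[OF A B f p \<nu>] \<mu>] True by blast
    also have "differential A B f p \<nu> \<mu> =
        frechet_derivative (local_rep \<kappa>' \<mu> f) (at (snd \<kappa>' p)) (\<nu> \<kappa>')"
      by (rule differential_in_chart[OF A f \<nu> \<kappa>' \<mu>])
    also have "frechet_derivative (local_rep \<mu> \<tau> h) (at (snd \<mu> (f p))) \<dots> =
        frechet_derivative (local_rep \<kappa>' \<tau> (\<lambda>x. h (f x))) (at (snd \<kappa>' p)) (\<nu> \<kappa>')"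
      using local_rep_chain[OF A B f h \<kappa>' \<mu>] True by simp
    finally show ?thesis using True by (simp add: differential_def \<kappa>'_def Let_def)
  qed (auto simp: differential_def)
qed

section \<open>Coordinates of tangent vectors\<close>

lemma transition_linear:
  assumes "smooth_atlas A" "\<kappa> \<in> A" "x \<in> fst \<kappa>" "\<mu> \<in> A" "x \<in> fst \<mu>"
  shows "linear (frechet_derivative (transition \<kappa> \<mu>) (at (snd \<kappa> x)))"
  by (rule has_derivative_linear[OF smooth_map_has_derivative[OF smooth_map_ident]]) (use assms in auto)

lemma transition_self:
  assumes A: "smooth_atlas A" and \<kappa>: "\<kappa> \<in> A" "x \<in> fst \<kappa>"
  shows "frechet_derivative (transition \<kappa> \<kappa>) (at (snd \<kappa> x)) b = b"
proof -
  have "open (snd \<kappa> ` fst \<kappa>)" using A \<kappa> unfolding smooth_atlas_def by blast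
  have "((\<lambda>y. y) has_derivative (\<lambda>b. b)) (at (snd \<kappa> x))" by (rule has_derivative_ident)
  then have "(transition \<kappa> \<kappa> has_derivative (\<lambda>b. b)) (at (snd \<kappa> x))"
    by (rule has_derivative_transform_within_open[where s = "snd \<kappa> ` fst \<kappa>", OF _ \<open>open _\<close>])
      (use \<kappa> smooth_atlas_inj[OF A \<kappa>(1)] in \<open>auto simp: local_rep_at\<close>)
  from frechet_derivative_at[OF this] show ?thesis by metis
qed

lemma coord_vec_tangent:
  assumes A: "smooth_atlas A" and \<kappa>: "\<kappa> \<in> A" "x \<in> fst \<kappa>"
  shows "coord_vec A \<kappa> x b \<in> tangent_space A x"
  unfolding tangent_space_def
proof (intro CollectI conjI allI impI ballI)
  show "coord_vec A \<kappa> x b \<mu> = 0" if "\<mu> \<notin> A \<or> x \<notin> fst \<mu>" for \<mu>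
    using that unfolding coord_vec_def by auto
  fix \<mu> \<mu>' assume "\<mu> \<in> A" "\<mu>' \<in> A" "x \<in> fst \<mu> \<inter> fst \<mu>'"
  then show "coord_vec A \<kappa> x b \<mu>' =
      frechet_derivative (transition \<mu> \<mu>') (at (snd \<mu> x)) (coord_vec A \<kappa> x b \<mu>)"
    using local_rep_chain[OF A A smooth_map_ident[OF A] smooth_map_ident[OF A] \<kappa>, of \<mu> \<mu>' b]
    by (simp add: coord_vec_def)
qed

lemma coord_vec_coord:
  assumes "smooth_atlas A" "\<kappa> \<in> A" "x \<in> fst \<kappa>"
  shows "coord_vec A \<kappa> x b \<kappa> = b"
  using assms by (simp add: coord_vec_def transition_self)

lemma coord_vec_of_coord:
  assumes \<nu>: "\<nu> \<in> tangent_space A x" and \<kappa>: "\<kappa> \<in> A" "x \<in> fst \<kappa>"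
  shows "coord_vec A \<kappa> x (\<nu> \<kappa>) = \<nu>"
proof
  fix \<mu>
  show "coord_vec A \<kappa> x (\<nu> \<kappa>) \<mu> = \<nu> \<mu>"
  proof (cases "\<mu> \<in> A \<and> x \<in> fst \<mu>")
    case True
    then show ?thesis
      using tangent_space_transition[OF \<nu> \<kappa>, of \<mu>] by (simp add: coord_vec_def)
  next
    case False
    then have "\<nu> \<mu> = 0" using \<nu> unfolding tangent_space_def by blast
    with False show ?thesis by (auto simp: coord_vec_def)
  qed
qed

lemma coord_vec_add:
  assumes "smooth_atlas A" "\<kappa> \<in> A" "x \<in> fst \<kappa>"
  shows "coord_vec A \<kappa> x (b + c) = (\<lambda>\<mu>. coord_vec A \<kappa> x b \<mu> + coord_vec A \<kappa> x c \<mu>)"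
  using transition_linear[OF assms] by (auto simp: coord_vec_def linear_add)

lemma coord_vec_scale:
  assumes "smooth_atlas A" "\<kappa> \<in> A" "x \<in> fst \<kappa>"
  shows "coord_vec A \<kappa> x (r *\<^sub>R b) = (\<lambda>\<mu>. r *\<^sub>R coord_vec A \<kappa> x b \<mu>)"
  using transition_linear[OF assms] by (auto simp: coord_vec_def linear_scale)

text \<open>Being linear on a tangent space, where vectors are families, is the same as being linear in
  the coordinates with respect to one chart.\<close>

lemma linear_in_coords:
  assumes A: "smooth_atlas A" and \<kappa>: "\<kappa> \<in> A" "x \<in> fst \<kappa>"
    and h: "linear_on_tangent (tangent_space A x) h"
  shows "linear (\<lambda>b. h (coord_vec A \<kappa> x b))"
  using h coord_vec_tangent[OF A \<kappa>] unfolding linear_on_tangent_def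
  by (intro linearI) (simp_all add: coord_vec_add[OF A \<kappa>] coord_vec_scale[OF A \<kappa>])

section \<open>The cross product on \<open>\<real>\<^sup>7\<close>\<close>

lemma UNIV_7: "(UNIV :: 7 set) = {1, 2, 3, 4, 5, 6, 7}"
proof -
  have "card {1, 2, 3, 4, 5, 6, 7 :: 7} = CARD(7)" by simp
  then show ?thesis by (intro card_subset_eq[symmetric]) simp_all
qed

lemma sum_7: "(\<Sum>i\<in>(UNIV :: 7 set). h i) = h 1 + h 2 + h 3 + h 4 + h 5 + h 6 + (h 7 :: real)"
  unfolding UNIV_7 by (simp add: algebra_simps)

text \<open>The vector that represents the linear form \<open>phi0 (\<cdot>, a, b)\<close>.\<close>

definition cross0 :: "real^7 \<Rightarrow> real^7 \<Rightarrow> real^7" where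
  "cross0 a b = (\<chi> i. phi0 (axis i 1) a b)"

lemma inner_cross0: "u \<bullet> cross0 a b = phi0 u a b"
  by (simp add: inner_vec_def sum_7 cross0_def phi0_def eps_def det_3 axis_def algebra_simps)

text \<open>Lagrange's identity. The seven terms of \<open>phi0\<close> are the lines of a Fano plane. The squares of
  the \<open>2 \<times> 2\<close> minors of \<open>(a, b)\<close> add up to the right-hand side. The products of different minors fall
  into seven groups of three, one group for the complement of each line, and each group is a
  Pluecker relation thanks to the signs.\<close>

lemma norm_cross0: "cross0 a b \<bullet> cross0 a b = (a \<bullet> a) * (b \<bullet> b) - (a \<bullet> b)\<^sup>2"
proof -
  have c: "cross0 a b $ 1 = a$2*b$3 - a$3*b$2 + (a$4*b$5 - a$5*b$4) - (a$6*b$7 - a$7*b$6)"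
    "cross0 a b $ 2 = a$3*b$1 - a$1*b$3 + (a$4*b$6 - a$6*b$4) - (a$7*b$5 - a$5*b$7)"
    "cross0 a b $ 3 = a$1*b$2 - a$2*b$1 + (a$4*b$7 - a$7*b$4) - (a$5*b$6 - a$6*b$5)"
    "cross0 a b $ 4 = a$5*b$1 - a$1*b$5 + (a$6*b$2 - a$2*b$6) + (a$7*b$3 - a$3*b$7)"
    "cross0 a b $ 5 = a$1*b$4 - a$4*b$1 - (a$2*b$7 - a$7*b$2) - (a$6*b$3 - a$3*b$6)"
    "cross0 a b $ 6 = - (a$7*b$1 - a$1*b$7) + (a$2*b$4 - a$4*b$2) - (a$3*b$5 - a$5*b$3)"
    "cross0 a b $ 7 = - (a$1*b$6 - a$6*b$1) - (a$5*b$2 - a$2*b$5) + (a$3*b$4 - a$4*b$3)"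
    by (simp_all add: cross0_def phi0_def eps_def det_3 axis_def algebra_simps)
  show ?thesis
    unfolding inner_vec_def inner_real_def sum_7 c by algebra
qed

section \<open>Metric and cross product in coordinates\<close>

locale g2_chart =
  fixes A :: "('x, real^7) chart set"
    and \<phi> :: "('x, real^7) trilinear_field"
    and g :: "('x, real^7) bilinear_field"
    and \<kappa> :: "('x, real^7) chart"
    and x :: 'x
  assumes g2: "g2_manifold A \<phi> g" and chart: "\<kappa> \<in> A" "x \<in> fst \<kappa>"
begin

lemma atlas: "smooth_atlas A"
  using g2 unfolding g2_manifold_def smooth_manifold_def by blast

lemma point: "x \<in> points A"
  using chart unfolding points_def by blast

text \<open>The rest of this section works with coordinates in \<open>\<real>\<^sup>7\<close> with respect to the chart \<open>\<kappa>\<close>; in them the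
  metric and the three-form at \<open>x\<close> become \<open>G\<close> and \<open>P\<close>, multilinear maps in the usual sense.\<close>

definition of_coords :: "real^7 \<Rightarrow> ('x, real^7) tvec" where
  "of_coords = coord_vec A \<kappa> x"

definition G :: "real^7 \<Rightarrow> real^7 \<Rightarrow> real" where
  "G b c = g x (of_coords b) (of_coords c)"

definition P :: "real^7 \<Rightarrow> real^7 \<Rightarrow> real^7 \<Rightarrow> real" where
  "P a b c = \<phi> x (of_coords a) (of_coords b) (of_coords c)"

lemma of_coords_tangent: "of_coords b \<in> tangent_space A x"
  unfolding of_coords_def by (rule coord_vec_tangent[OF atlas chart])

lemma of_coords_coord: "of_coords b \<kappa> = b"
  unfolding of_coords_def by (rule coord_vec_coord[OF atlas chart])

lemma of_coords_of_coord: "\<nu> \<in> tangent_space A x \<Longrightarrow> of_coords (\<nu> \<kappa>) = \<nu>"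
  unfolding of_coords_def by (rule coord_vec_of_coord[OF _ chart])

lemma metric:
  assumes "u \<in> tangent_space A x"
  shows "linear_on_tangent (tangent_space A x) (g x u)"
    and "v \<in> tangent_space A x \<Longrightarrow> g x u v = g x v u"
    and "u \<noteq> (\<lambda>\<kappa>. 0) \<Longrightarrow> g x u u > 0"
  using g2 point assms unfolding g2_manifold_def riemannian_metric_def by blast+

lemma form:
  assumes "u \<in> tangent_space A x" "v \<in> tangent_space A x"
  shows "linear_on_tangent (tangent_space A x) (\<phi> x u v)"
    and "w \<in> tangent_space A x \<Longrightarrow> \<phi> x v u w = - \<phi> x u v w"
    and "w \<in> tangent_space A x \<Longrightarrow> \<phi> x u w v = - \<phi> x u v w"
  using g2 point assms unfolding g2_manifold_def smooth_three_form_def by blast+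

lemma G_linear_right: "linear (G b)"
  using linear_in_coords[OF atlas chart metric(1)[OF of_coords_tangent[of b]]]
  unfolding G_def of_coords_def .

lemma G_sym: "G b c = G c b"
  unfolding G_def by (intro metric of_coords_tangent)

lemma G_linear_left: "linear (\<lambda>b. G b c)"
proof -
  have "(\<lambda>b. G b c) = G c" by (rule ext) (rule G_sym)
  then show ?thesis using G_linear_right by simp
qed

lemma G_pos: "b \<noteq> 0 \<Longrightarrow> G b b > 0"
  unfolding G_def by (rule metric(3)[OF of_coords_tangent]) (metis of_coords_coord)

lemma P_swap: "P b a c = - P a b c" "P a c b = - P a b c"
  unfolding P_def by (intro form of_coords_tangent)+

lemma P_linear3: "linear (P a b)"
  using linear_in_coords[OF atlas chart form(1)[OF of_coords_tangent[of a] of_coords_tangent[of b]]]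
  unfolding P_def of_coords_def .

lemma P_linear2: "linear (\<lambda>b. P a b c)"
proof -
  have "(\<lambda>b. P a b c) = (\<lambda>b. - P a c b)" by (rule ext) (rule P_swap(2))
  then show ?thesis using linear_compose_neg[OF P_linear3[of a c]] by simp
qed

lemma P_linear1: "linear (\<lambda>a. P a b c)"
proof -
  have "(\<lambda>a. P a b c) = (\<lambda>a. - P b a c)" by (rule ext) (rule P_swap(1))
  then show ?thesis using linear_compose_neg[OF P_linear2[of b c]] by simp
qed

lemma P_repeat: "P a b b = 0" "P a b a = 0" "P a a b = 0"
  using P_swap(2)[of a b b] P_swap(1)[of a a b] P_swap(2)[of a b a] by simp_all

lemmas G_simps =
  linear_add[OF G_linear_left] linear_scale[OF G_linear_left]
  linear_add[OF G_linear_right] linear_scale[OF G_linear_right]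
  linear_diff[OF G_linear_right] linear_diff[OF G_linear_left]

lemmas P_simps =
  linear_add[OF P_linear1] linear_scale[OF P_linear1]
  linear_add[OF P_linear2] linear_scale[OF P_linear2]
  linear_add[OF P_linear3] linear_scale[OF P_linear3]

lemma frame_comb_vec:
  assumes "\<And>i. e i \<in> tangent_space A x"
  shows "frame_comb e a = of_coords (\<Sum>i\<in>UNIV. a $ i *\<^sub>R e i \<kappa>)"
proof
  fix \<mu>
  show "frame_comb e a \<mu> = of_coords (\<Sum>i\<in>UNIV. a $ i *\<^sub>R e i \<kappa>) \<mu>"
  proof (cases "\<mu> \<in> A \<and> x \<in> fst \<mu>")
    case True
    then have lin: "linear (frechet_derivative (transition \<kappa> \<mu>) (at (snd \<kappa> x)))"
      using transition_linear[OF atlas chart] by blast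
    have "e i \<mu> = frechet_derivative (transition \<kappa> \<mu>) (at (snd \<kappa> x)) (e i \<kappa>)" for i
      using tangent_space_transition[OF assms chart] True by blast
    with True show ?thesis
      by (simp add: frame_comb_def of_coords_def coord_vec_def linear_sum[OF lin] linear_scale[OF lin])
  next
    case False
    then have "e i \<mu> = 0" for i using assms[of i] unfolding tangent_space_def by blast
    with False show ?thesis by (auto simp: frame_comb_def of_coords_def coord_vec_def)
  qed
qed

text \<open>A \<open>G\<^sub>2\<close>-frame carries the cross product of \<open>\<real>\<^sup>7\<close> over to the tangent space.\<close>

lemma cross_exists:
  obtains z where "\<And>u. G u z = P u b c" "G z z = G b b * G c c - (G b c)\<^sup>2"
proof -
  obtain e where e: "g2_frame A \<phi> x e"
    using g2 point unfolding g2_manifold_def by blast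
  then have eT: "\<And>i. e i \<in> tangent_space A x"
    and ex: "\<And>u. u \<in> tangent_space A x \<Longrightarrow> \<exists>!a. u = frame_comb e a"
    and \<phi>e: "\<And>a b c. \<phi> x (frame_comb e a) (frame_comb e b) (frame_comb e c) = phi0 a b c"
    unfolding g2_frame_def by blast+
  have orth: "g x (e i) (e j) = (if i = j then 1 else 0)" for i j
    using g2 point e unfolding g2_manifold_def by blast
  define L where "L a = (\<Sum>i\<in>UNIV. a $ i *\<^sub>R e i \<kappa>)" for a :: "real^7"
  have frame: "frame_comb e a = of_coords (L a)" for a
    unfolding L_def by (rule frame_comb_vec[OF eT])
  have surj: "\<exists>a. b = L a" for b
    using ex[OF of_coords_tangent[of b]] of_coords_coord unfolding frame by metis
  have P_L: "P (L a) (L b) (L c) = phi0 a b c" for a b c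
    using \<phi>e unfolding P_def frame .
  have Ge: "G (e i \<kappa>) (e j \<kappa>) = (if i = j then 1 else 0)" for i j
    by (simp add: G_def of_coords_of_coord eT orth)
  have G_L: "G (L a) (L b) = a \<bullet> b" for a b
    by (simp add: L_def linear_sum[OF G_linear_left] linear_sum[OF G_linear_right] G_simps
        inner_vec_def Ge if_distrib mult.commute cong: if_cong)
  obtain a1 a2 where a: "b = L a1" "c = L a2" using surj by blast
  show thesis
  proof
    show "G u (L (cross0 a1 a2)) = P u b c" for u
      using surj[of u] by (auto simp: a G_L P_L inner_cross0)
    show "G (L (cross0 a1 a2)) (L (cross0 a1 a2)) = G b b * G c c - (G b c)\<^sup>2"
      by (simp add: a G_L norm_cross0)
  qed
qed

lemma G_nondegenerate:
  assumes "\<And>u. G u z = G u z'"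
  shows "z = z'"
  using G_pos[of "z - z'"] assms[of "z - z'"] by (auto simp: G_simps)

lemma cross_product_vec:
  assumes "\<And>u. G u z = P u b c"
  shows "cross_product A \<phi> g x (of_coords b) (of_coords c) = of_coords z"
  unfolding cross_product_def
proof (rule the_equality)
  have all: "(\<forall>u\<in>tangent_space A x. g x u w = \<phi> x u (of_coords b) (of_coords c)) \<longleftrightarrow> (\<forall>a. G a (w \<kappa>) = P a b c)"
    if "w \<in> tangent_space A x" for w
    unfolding G_def P_def of_coords_of_coord[OF that] using of_coords_tangent of_coords_of_coord by metis
  show "of_coords z \<in> tangent_space A x \<and> (\<forall>u\<in>tangent_space A x. g x u (of_coords z) = \<phi> x u (of_coords b) (of_coords c))"
    using all[OF of_coords_tangent[of z]] assms by (simp add: of_coords_tangent of_coords_coord)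
  fix w
  assume "w \<in> tangent_space A x \<and> (\<forall>u\<in>tangent_space A x. g x u w = \<phi> x u (of_coords b) (of_coords c))"
  then have "w \<in> tangent_space A x" "\<And>a. G a (w \<kappa>) = P a b c" using all by blast+
  then have "w \<kappa> = z" using assms by (intro G_nondegenerate) simp
  then show "w = of_coords z" using of_coords_of_coord[OF \<open>w \<in> _\<close>] by simp
qed

lemma gram_pos:
  assumes "\<And>\<alpha> \<beta>. \<alpha> *\<^sub>R b + \<beta> *\<^sub>R c = 0 \<Longrightarrow> \<alpha> = 0 \<and> \<beta> = 0"
  shows "G b b > 0" "G b b * G c c - (G b c)\<^sup>2 > 0"
proof -
  show b: "G b b > 0" using assms[of 1 0] G_pos by fastforce
  \<comment> \<open>The vector is the component of \<open>c\<close> orthogonal to \<open>b\<close>, multiplied by \<open>G b b\<close> to avoid division.\<close>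
  have "0 < G (G b b *\<^sub>R c + (- G b c) *\<^sub>R b) (G b b *\<^sub>R c + (- G b c) *\<^sub>R b)"
    using assms[of "- G b c" "G b b"] b by (intro G_pos) (auto simp: add.commute)
  also have "\<dots> = G b b * (G b b * G c c - (G b c)\<^sup>2)"
    by (simp only: G_simps G_sym[of c b]) (simp add: algebra_simps power2_eq_square)
  finally show "G b b * G c c - (G b c)\<^sup>2 > 0" using b by (simp add: zero_less_mult_iff)
qed

text \<open>For a basis with coefficient matrix of determinant \<open>m\<close> with respect to \<open>b, c\<close> both the cross
  product and, after taking squares, the Gram determinant scale by \<open>m\<close>. So all oriented
  orthonormal bases have the same \<open>m\<close>, namely one over the area of the parallelogram spanned by
  \<open>b\<close> and \<open>c\<close>; Gram--Schmidt provides one such basis.\<close>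

lemma plane_normal_vec:
  assumes ind: "\<And>\<alpha> \<beta>. \<alpha> *\<^sub>R b + \<beta> *\<^sub>R c = 0 \<Longrightarrow> \<alpha> = 0 \<and> \<beta> = 0"
    and z: "\<And>u. G u z = P u b c"
  obtains r where "r > 0" "G (r *\<^sub>R z) (r *\<^sub>R z) = 1"
    "plane_normal A \<phi> g x {(of_coords (\<alpha> *\<^sub>R b + \<beta> *\<^sub>R c), of_coords (\<gamma> *\<^sub>R b + \<delta> *\<^sub>R c)) |
       \<alpha> \<beta> \<gamma> \<delta>. \<alpha> * \<delta> - \<beta> * \<gamma> > 0} = of_coords (r *\<^sub>R z)"
proof
  let ?D = "G b b * G c c - (G b c)\<^sup>2"
  define s where "s = sqrt ?D"
  define t where "t = sqrt (G b b)"
  have s: "s > 0" "s\<^sup>2 = ?D" and t: "t > 0" "t\<^sup>2 = G b b"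
    using gram_pos[OF ind] unfolding s_def t_def by (simp_all add: less_imp_le)
  show "1 / s > 0" using s by simp
  obtain z' where z': "\<And>u. G u z' = P u b c" "G z' z' = ?D"
    using cross_exists[of b c] by blast
  have "z = z'" using z z' by (intro G_nondegenerate) simp
  then show "G ((1 / s) *\<^sub>R z) ((1 / s) *\<^sub>R z) = 1"
    using z'(2)[folded s(2)] s(1) by (simp add: G_simps power2_eq_square)
  let ?\<xi> = "{(of_coords (\<alpha> *\<^sub>R b + \<beta> *\<^sub>R c), of_coords (\<gamma> *\<^sub>R b + \<delta> *\<^sub>R c)) | \<alpha> \<beta> \<gamma> \<delta>. \<alpha> * \<delta> - \<beta> * \<gamma> > 0}"
  have memI: "(of_coords (\<alpha> *\<^sub>R b + \<beta> *\<^sub>R c), of_coords (\<gamma> *\<^sub>R b + \<delta> *\<^sub>R c)) \<in> ?\<xi>"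
    if "\<alpha> * \<delta> - \<beta> * \<gamma> > 0" for \<alpha> \<beta> \<gamma> \<delta>
    using that by blast
  have cross: "cross_product A \<phi> g x (of_coords (\<alpha> *\<^sub>R b + \<beta> *\<^sub>R c)) (of_coords (\<gamma> *\<^sub>R b + \<delta> *\<^sub>R c)) =
      of_coords ((\<alpha> * \<delta> - \<beta> * \<gamma>) *\<^sub>R z)" for \<alpha> \<beta> \<gamma> \<delta>
    by (rule cross_product_vec)
      (simp add: G_simps P_simps P_repeat z P_swap(2)[of _ c b] algebra_simps)
  show "plane_normal A \<phi> g x ?\<xi> = of_coords ((1 / s) *\<^sub>R z)"
    unfolding plane_normal_def
  proof (rule the_equality)
    \<comment> \<open>Gram--Schmidt: normalise \<open>b\<close>, then normalise the component of \<open>c\<close> orthogonal to it, which has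
      length \<open>s / t\<close>.\<close>
    let ?\<gamma> = "- (G b c) / (t * s)" and ?\<delta> = "t / s"
    have tt: "G b b = t * t" and ss: "s * s = t * t * G c c - (G b c)\<^sup>2"
      using t(2) s(2) by (simp_all add: power2_eq_square)
    have "(of_coords ((1 / t) *\<^sub>R b + 0 *\<^sub>R c), of_coords (?\<gamma> *\<^sub>R b + ?\<delta> *\<^sub>R c)) \<in> ?\<xi>"
      by (rule memI) (use s t in simp)
    moreover have "G ((1 / t) *\<^sub>R b + 0 *\<^sub>R c) ((1 / t) *\<^sub>R b + 0 *\<^sub>R c) = 1"
      using t by (simp add: G_simps tt)
    moreover have "G ((1 / t) *\<^sub>R b + 0 *\<^sub>R c) (?\<gamma> *\<^sub>R b + ?\<delta> *\<^sub>R c) = 0"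
      using t s(1) by (simp add: G_simps tt)
    moreover have "G (?\<gamma> *\<^sub>R b + ?\<delta> *\<^sub>R c) (?\<gamma> *\<^sub>R b + ?\<delta> *\<^sub>R c) = 1"
    proof -
      have "G (?\<gamma> *\<^sub>R b + ?\<delta> *\<^sub>R c) (?\<gamma> *\<^sub>R b + ?\<delta> *\<^sub>R c) =
          (t * t * G c c - (G b c)\<^sup>2) / (s * s)"
        using t(1) s(1) by (simp add: G_simps tt G_sym[of c b] field_simps power2_eq_square)
      then show ?thesis using s(1) by (simp add: ss[symmetric])
    qed
    moreover have "of_coords ((1 / s) *\<^sub>R z) = cross_product A \<phi> g x
        (of_coords ((1 / t) *\<^sub>R b + 0 *\<^sub>R c)) (of_coords (?\<gamma> *\<^sub>R b + ?\<delta> *\<^sub>R c))"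
      unfolding cross using t by simp
    ultimately show "\<exists>u v. (u, v) \<in> ?\<xi> \<and> g x u u = 1 \<and> g x v v = 1 \<and> g x u v = 0 \<and>
        of_coords ((1 / s) *\<^sub>R z) = cross_product A \<phi> g x u v"
      unfolding G_def by blast
  next
    fix \<eta>
    assume "\<exists>u v. (u, v) \<in> ?\<xi> \<and> g x u u = 1 \<and> g x v v = 1 \<and> g x u v = 0 \<and>
        \<eta> = cross_product A \<phi> g x u v"
    then obtain \<alpha> \<beta> \<gamma> \<delta> where m: "\<alpha> * \<delta> - \<beta> * \<gamma> > 0"
      and u: "G (\<alpha> *\<^sub>R b + \<beta> *\<^sub>R c) (\<alpha> *\<^sub>R b + \<beta> *\<^sub>R c) = 1"
      and v: "G (\<gamma> *\<^sub>R b + \<delta> *\<^sub>R c) (\<gamma> *\<^sub>R b + \<delta> *\<^sub>R c) = 1"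
      and uv: "G (\<alpha> *\<^sub>R b + \<beta> *\<^sub>R c) (\<gamma> *\<^sub>R b + \<delta> *\<^sub>R c) = 0"
      and \<eta>: "\<eta> = of_coords ((\<alpha> * \<delta> - \<beta> * \<gamma>) *\<^sub>R z)"
      unfolding G_def using cross by auto
    have "(\<alpha> * \<delta> - \<beta> * \<gamma>)\<^sup>2 * ?D =
        G (\<alpha> *\<^sub>R b + \<beta> *\<^sub>R c) (\<alpha> *\<^sub>R b + \<beta> *\<^sub>R c) * G (\<gamma> *\<^sub>R b + \<delta> *\<^sub>R c) (\<gamma> *\<^sub>R b + \<delta> *\<^sub>R c)
        - (G (\<alpha> *\<^sub>R b + \<beta> *\<^sub>R c) (\<gamma> *\<^sub>R b + \<delta> *\<^sub>R c))\<^sup>2"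
      by (simp add: G_simps G_sym[of c b] power2_eq_square algebra_simps)
    then have "((\<alpha> * \<delta> - \<beta> * \<gamma>) * s)\<^sup>2 = 1\<^sup>2"
      unfolding u v uv power_mult_distrib s(2) by simp
    then have "(\<alpha> * \<delta> - \<beta> * \<gamma>) * s = 1"
      by (rule power2_eq_imp_eq) (use m s(1) in simp_all)
    then have "\<alpha> * \<delta> - \<beta> * \<gamma> = 1 / s" using s(1) by (simp add: field_simps)
    then show "\<eta> = of_coords ((1 / s) *\<^sub>R z)" unfolding \<eta> by simp
  qed
qed

lemma metric_coeff_at: "metric_coeff A g \<kappa> i j (snd \<kappa> x) = G (axis i 1) (axis j 1)"
  using inv_into_f_f[OF smooth_atlas_inj[OF atlas chart(1)] chart(2)]
  by (simp add: metric_coeff_def coord_field_def G_def of_coords_def)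

lemma form_coeff_at: "form_coeff A \<phi> \<kappa> i j k (snd \<kappa> x) = P (axis i 1) (axis j 1) (axis k 1)"
  using inv_into_f_f[OF smooth_atlas_inj[OF atlas chart(1)] chart(2)]
  by (simp add: form_coeff_def coord_field_def P_def of_coords_def)

lemma basis_sum: "(\<Sum>i\<in>UNIV. (b $ i) *\<^sub>R axis i 1) = (b :: real^7)"
  using basis_expansion[of b] by (simp add: scalar_mult_eq_scaleR)

lemma metric_matrix_mult: "((\<chi> i j. metric_coeff A g \<kappa> i j (snd \<kappa> x)) *v b) $ i = G (axis i 1) b"
proof -
  have "G (axis i 1) b = G (axis i 1) (\<Sum>j\<in>UNIV. (b $ j) *\<^sub>R axis j 1)" by (simp add: basis_sum)
  then show ?thesis
    by (simp add: matrix_vector_mult_def metric_coeff_at linear_sum[OF G_linear_right] G_simps mult.commute)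
qed

lemma metric_matrix_det: "det (\<chi> i j. metric_coeff A g \<kappa> i j (snd \<kappa> x)) \<noteq> 0"
proof -
  let ?M = "\<chi> i j. metric_coeff A g \<kappa> i j (snd \<kappa> x)"
  have "b = 0" if "?M *v b = 0" for b
  proof -
    have "G (axis i 1) b = 0" for i
      using metric_matrix_mult[of b i] that by simp
    then have "G (\<Sum>i\<in>UNIV. (b $ i) *\<^sub>R axis i 1) b = 0"
      by (simp add: linear_sum[OF G_linear_left] G_simps)
    then have "G b b = 0" unfolding basis_sum .
    then show "b = 0" using G_pos by force
  qed
  then show ?thesis
    by (metis invertible_det_nz invertible_left_inverse matrix_left_invertible_ker)
qed

lemma form_coeff_sum:
  "(\<Sum>j\<in>UNIV. \<Sum>k\<in>UNIV. form_coeff A \<phi> \<kappa> i j k (snd \<kappa> x) * (b $ j * c $ k)) = P (axis i 1) b c"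
proof -
  have "P (axis i 1) b c =
      P (axis i 1) (\<Sum>j\<in>UNIV. (b $ j) *\<^sub>R axis j 1) (\<Sum>k\<in>UNIV. (c $ k) *\<^sub>R axis k 1)"
    by (simp only: basis_sum)
  also have "\<dots> = (\<Sum>k\<in>UNIV. \<Sum>j\<in>UNIV. form_coeff A \<phi> \<kappa> i j k (snd \<kappa> x) * (b $ j * c $ k))"
    by (simp add: linear_sum[OF P_linear2] linear_sum[OF P_linear3] P_simps form_coeff_at
        sum_distrib_left mult_ac)
  also have "\<dots> = (\<Sum>j\<in>UNIV. \<Sum>k\<in>UNIV. form_coeff A \<phi> \<kappa> i j k (snd \<kappa> x) * (b $ j * c $ k))"
    by (rule sum.swap)
  finally show ?thesis by simp
qed

lemma metric_matrix_solve:
  assumes "\<And>u. G u z = P u b c"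
  shows "(\<chi> i j. metric_coeff A g \<kappa> i j (snd \<kappa> x)) *v z =
    (\<chi> i. \<Sum>j\<in>UNIV. \<Sum>k\<in>UNIV. form_coeff A \<phi> \<kappa> i j k (snd \<kappa> x) * (b $ j * c $ k))"
  by (simp add: vec_eq_iff metric_matrix_mult form_coeff_sum assms)

end

section \<open>The unit sphere bundle\<close>

text \<open>Central projection from the origin onto the affine hyperplane where the first component is
  \<open>1\<close>. It does not see positive factors, so unit vectors never have to be normalised explicitly and
  no square root enters a smoothness proof.\<close>

definition central :: "real \<times> 'b \<Rightarrow> 'b::real_vector" where
  "central z = (1 / fst z) *\<^sub>R snd z"

lemma central_scale: "r \<noteq> 0 \<Longrightarrow> central (r *\<^sub>R z) = central z"
  by (simp add: central_def)

lemma central_ray: "fst z \<noteq> 0 \<Longrightarrow> z = fst z *\<^sub>R (1, central z)"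
  by (simp add: central_def prod_eq_iff)

lemma smooth_on_central:
  fixes z :: "'a::real_normed_vector \<Rightarrow> real \<times> 'b::euclidean_space"
  assumes S: "open S" and z: "smooth_on S z" and "\<And>s. s \<in> S \<Longrightarrow> fst (z s) \<noteq> 0"
  shows "smooth_on S (\<lambda>s. central (z s))"
  unfolding central_def
  using assms(3) by (intro smooth_on_scaleR smooth_on_divide smooth_on_const S
      smooth_on_linear[OF linear_fst S z] smooth_on_linear[OF linear_snd S z])

lemma smooth_on_frechet_apply:
  fixes f :: "'b::euclidean_space \<Rightarrow> 'c::real_normed_vector"
    and h v :: "'a::real_normed_vector \<Rightarrow> 'b"
  assumes S: "open S" and f: "smooth_on T f" and h: "smooth_on S h" "h ` S \<subseteq> T"
    and v: "smooth_on S v"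
  shows "smooth_on S (\<lambda>s. frechet_derivative f (at (h s)) (v s))"
proof (rule smooth_on_cong[OF _ S])
  show "smooth_on S (\<lambda>s. \<Sum>b\<in>Basis. (v s \<bullet> b) *\<^sub>R frechet_derivative f (at (h s)) b)"
  proof (intro smooth_on_sum smooth_on_scaleR S)
    show "smooth_on S (\<lambda>s. v s \<bullet> b)" for b
      by (rule smooth_on_linear[OF _ S v]) (auto intro!: linearI simp: inner_add_left)
    show "smooth_on S (\<lambda>s. frechet_derivative f (at (h s)) b)" for b
      by (rule smooth_on_compose[OF S h(1) smooth_on_frechet_derivative[OF f] h(2)])
  qed
  fix s assume "s \<in> S"
  then have "(f has_derivative frechet_derivative f (at (h s))) (at (h s))"
    using h(2) by (intro smooth_on_has_derivative[OF f]) blast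
  then have lin: "linear (frechet_derivative f (at (h s)))" by (rule has_derivative_linear)
  have "frechet_derivative f (at (h s)) (v s) =
      frechet_derivative f (at (h s)) (\<Sum>b\<in>Basis. (v s \<bullet> b) *\<^sub>R b)"
    by (simp only: euclidean_representation)
  then show "(\<Sum>b\<in>Basis. (v s \<bullet> b) *\<^sub>R frechet_derivative f (at (h s)) b) =
      frechet_derivative f (at (h s)) (v s)"
    by (simp add: linear_sum[OF lin] linear_scale[OF lin])
qed

lemma sphere_chart_domain:
  "(x, \<nu>) \<in> fst (sphere_chart A g \<kappa> \<Phi>) \<longleftrightarrow>
     x \<in> fst \<kappa> \<and> \<nu> \<in> tangent_space A x \<and> g x \<nu> \<nu> = 1 \<and> fst (\<Phi> (\<nu> \<kappa>)) > 0"
  by (simp add: sphere_chart_def)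

lemma sphere_chart_map:
  "snd (sphere_chart A g \<kappa> \<Phi>) (x, \<nu>) = (snd \<kappa> x, central (\<Phi> (\<nu> \<kappa>)))"
  by (simp add: sphere_chart_def central_def)

lemma linear_inv:
  assumes "linear \<Phi>" "bij \<Phi>"
  shows "linear (inv \<Phi>)"
proof -
  have "inv \<Phi> = h" if "h \<circ> \<Phi> = id" for h
    using that assms(2) by (metis bij_def fun.map_id0 id_apply comp_assoc comp_id surj_iff id_comp)
  moreover obtain h where "linear h" "h \<circ> \<Phi> = id"
    using linear_injective_left_inverse[OF assms(1) bij_is_inj[OF assms(2)]] by blast
  ultimately show ?thesis by metis
qed

locale riemannian_atlas =
  fixes A :: "('x, real^7) chart set" and g :: "('x, real^7) bilinear_field"
  assumes atlas: "smooth_atlas A" and metric: "riemannian_metric A g"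
begin

lemma metric_square:
  assumes \<kappa>: "\<kappa> \<in> A" "x \<in> fst \<kappa>"
  shows "g x (coord_vec A \<kappa> x (r *\<^sub>R b)) (coord_vec A \<kappa> x (r *\<^sub>R b)) =
      r\<^sup>2 * g x (coord_vec A \<kappa> x b) (coord_vec A \<kappa> x b)"
    and "b \<noteq> 0 \<Longrightarrow> g x (coord_vec A \<kappa> x b) (coord_vec A \<kappa> x b) > 0"
proof -
  let ?c = "coord_vec A \<kappa> x"
  have x: "x \<in> points A" using \<kappa> unfolding points_def by blast
  have T: "?c b \<in> tangent_space A x" for b by (rule coord_vec_tangent[OF atlas \<kappa>])
  have lin: "linear (\<lambda>b. g x (?c a) (?c b))" for a
    by (rule linear_in_coords[OF atlas \<kappa>])
      (use metric x T[of a] in \<open>unfold riemannian_metric_def, blast\<close>)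
  have sym: "g x (?c a) (?c b) = g x (?c b) (?c a)" for a b
    using metric x T[of a] T[of b] unfolding riemannian_metric_def by blast
  have "g x (?c (r *\<^sub>R b)) (?c (r *\<^sub>R b)) = r * g x (?c (r *\<^sub>R b)) (?c b)"
    using linear_scale[OF lin] by simp
  also have "g x (?c (r *\<^sub>R b)) (?c b) = g x (?c b) (?c (r *\<^sub>R b))" by (rule sym)
  also have "\<dots> = r * g x (?c b) (?c b)" using linear_scale[OF lin] by simp
  finally show "g x (?c (r *\<^sub>R b)) (?c (r *\<^sub>R b)) = r\<^sup>2 * g x (?c b) (?c b)"
    by (simp add: power2_eq_square)
  assume "b \<noteq> 0"
  then have "?c b \<noteq> (\<lambda>\<kappa>. 0)" using coord_vec_coord[OF atlas \<kappa>, of b] by metis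
  then show "g x (?c b) (?c b) > 0"
    using metric x T[of b] unfolding riemannian_metric_def by blast
qed

text \<open>A unit vector lies on the ray of its central projection; the metric determines its position on
  the ray. Both the injectivity of the chart and its surjectivity onto a product rest on this.\<close>

lemma sphere_chart_ray:
  assumes \<Phi>: "linear \<Phi>" "bij \<Phi>" and \<nu>: "(x, \<nu>) \<in> fst (sphere_chart A g \<kappa> \<Phi>)"
  shows "\<nu> \<kappa> = fst (\<Phi> (\<nu> \<kappa>)) *\<^sub>R inv \<Phi> (1, central (\<Phi> (\<nu> \<kappa>)))"
proof -
  have "\<Phi> (\<nu> \<kappa>) = fst (\<Phi> (\<nu> \<kappa>)) *\<^sub>R (1, central (\<Phi> (\<nu> \<kappa>)))"
    using \<nu> by (intro central_ray) (simp add: sphere_chart_domain)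
  then have "inv \<Phi> (\<Phi> (\<nu> \<kappa>)) = fst (\<Phi> (\<nu> \<kappa>)) *\<^sub>R inv \<Phi> (1, central (\<Phi> (\<nu> \<kappa>)))"
    using linear_scale[OF linear_inv[OF \<Phi>]] by metis
  then show ?thesis using bij_is_inj[OF \<Phi>(2)] by simp
qed

lemma sphere_chart_inj:
  assumes \<Phi>: "linear \<Phi>" "bij \<Phi>" and \<kappa>: "\<kappa> \<in> A"
  shows "inj_on (snd (sphere_chart A g \<kappa> \<Phi>)) (fst (sphere_chart A g \<kappa> \<Phi>))"
proof (rule inj_onI, clarify)
  fix x \<nu> x' \<nu>'
  assume d: "(x, \<nu>) \<in> fst (sphere_chart A g \<kappa> \<Phi>)" "(x', \<nu>') \<in> fst (sphere_chart A g \<kappa> \<Phi>)"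
    and "snd (sphere_chart A g \<kappa> \<Phi>) (x, \<nu>) = snd (sphere_chart A g \<kappa> \<Phi>) (x', \<nu>')"
  then have x: "snd \<kappa> x = snd \<kappa> x'" and t: "central (\<Phi> (\<nu> \<kappa>)) = central (\<Phi> (\<nu>' \<kappa>))"
    by (simp_all add: sphere_chart_map)
  have D: "x \<in> fst \<kappa>" "\<nu> \<in> tangent_space A x" "g x \<nu> \<nu> = 1" "fst (\<Phi> (\<nu> \<kappa>)) > 0"
    "x' \<in> fst \<kappa>" "\<nu>' \<in> tangent_space A x'" "g x' \<nu>' \<nu>' = 1" "fst (\<Phi> (\<nu>' \<kappa>)) > 0"
    using d by (simp_all add: sphere_chart_domain)
  have [simp]: "x' = x"
    using smooth_atlas_inj[OF atlas \<kappa>] x D unfolding inj_on_def by metis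
  let ?b = "inv \<Phi> (1, central (\<Phi> (\<nu>' \<kappa>)))" and ?c = "coord_vec A \<kappa> x"
  define m m' where "m = fst (\<Phi> (\<nu> \<kappa>))" and "m' = fst (\<Phi> (\<nu>' \<kappa>))"
  have b: "?c (m *\<^sub>R ?b) = \<nu>" "?c (m' *\<^sub>R ?b) = \<nu>'"
    using sphere_chart_ray[OF \<Phi> d(1)] sphere_chart_ray[OF \<Phi> d(2)] D t
      coord_vec_of_coord[OF D(2) \<kappa>] coord_vec_of_coord[OF D(6) \<kappa>] by (simp_all add: m_def m'_def)
  have "m\<^sup>2 * g x (?c ?b) (?c ?b) = 1" "m'\<^sup>2 * g x (?c ?b) (?c ?b) = 1"
    using metric_square(1)[OF \<kappa> D(1), of m ?b] metric_square(1)[OF \<kappa> D(1), of m' ?b] D(3,7)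
    unfolding b by simp_all
  then have "m\<^sup>2 = m'\<^sup>2"
    by (metis mult_cancel_right mult_zero_right zero_neq_one)
  then have "m = m'"
    by (rule power2_eq_imp_eq) (use D(4,8) in \<open>simp_all add: m_def m'_def\<close>)
  have "\<nu> = ?c (m *\<^sub>R ?b)" by (rule b(1)[symmetric])
  also have "\<dots> = \<nu>'" unfolding \<open>m = m'\<close> by (rule b(2))
  finally show "x = x' \<and> \<nu> = \<nu>'" by simp
qed

lemma sphere_chart_surj:
  assumes \<Phi>: "linear \<Phi>" "bij \<Phi>" and \<kappa>: "\<kappa> \<in> A" "x \<in> fst \<kappa>"
  obtains \<nu> where "(x, \<nu>) \<in> fst (sphere_chart A g \<kappa> \<Phi>)"
    "snd (sphere_chart A g \<kappa> \<Phi>) (x, \<nu>) = (snd \<kappa> x, t)"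
proof
  let ?b = "inv \<Phi> (1, t)" and ?c = "coord_vec A \<kappa> x"
  define r where "r = 1 / sqrt (g x (?c ?b) (?c ?b))"
  have \<Phi>b: "\<Phi> ?b = (1, t)" using bij_is_surj[OF \<Phi>(2)] by (rule surj_f_inv_f)
  then have "?b \<noteq> 0" using linear_0[OF \<Phi>(1)] by (auto simp: zero_prod_def)
  then have pos: "g x (?c ?b) (?c ?b) > 0" by (rule metric_square(2)[OF \<kappa>])
  then have r: "r > 0" "r\<^sup>2 * g x (?c ?b) (?c ?b) = 1"
    by (simp_all add: r_def power_divide)
  have c: "?c (r *\<^sub>R ?b) \<kappa> = r *\<^sub>R ?b" by (rule coord_vec_coord[OF atlas \<kappa>])
  have \<Phi>r: "\<Phi> (?c (r *\<^sub>R ?b) \<kappa>) = r *\<^sub>R (1, t)" by (simp add: c linear_scale[OF \<Phi>(1)] \<Phi>b)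
  show "(x, ?c (r *\<^sub>R ?b)) \<in> fst (sphere_chart A g \<kappa> \<Phi>)"
    unfolding sphere_chart_domain metric_square(1)[OF \<kappa>] \<Phi>r
    using r \<kappa> coord_vec_tangent[OF atlas \<kappa>] by simp
  show "snd (sphere_chart A g \<kappa> \<Phi>) (x, ?c (r *\<^sub>R ?b)) = (snd \<kappa> x, t)"
    unfolding sphere_chart_map \<Phi>r using r(1) by (simp add: central_def)
qed

lemma sphere_chart_image:
  assumes \<Phi>: "linear \<Phi>" "bij \<Phi>" and \<kappa>: "\<kappa> \<in> A"
  shows "snd (sphere_chart A g \<kappa> \<Phi>) ` (fst (sphere_chart A g \<kappa> \<Phi>) \<inter> fst -` W) =
    snd \<kappa> ` (fst \<kappa> \<inter> W) \<times> UNIV" (is "?l = ?r")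
proof
  show "?l \<subseteq> ?r" by (auto simp: sphere_chart_map sphere_chart_domain)
  show "?r \<subseteq> ?l"
  proof clarify
    fix x t assume x: "x \<in> fst \<kappa>" "x \<in> W"
    obtain \<nu> where "(x, \<nu>) \<in> fst (sphere_chart A g \<kappa> \<Phi>)"
      "snd (sphere_chart A g \<kappa> \<Phi>) (x, \<nu>) = (snd \<kappa> x, t)"
      by (rule sphere_chart_surj[OF \<Phi> \<kappa> x(1)])
    with x show "(snd \<kappa> x, t) \<in> ?l" by (intro image_eqI[of _ _ "(x, \<nu>)"]) auto
  qed
qed

text \<open>The coordinate vector of a point of the sphere bundle is a positive multiple of
  \<open>\<Phi>\<inverse> (1, t)\<close>. The multiple involves the metric, but it is cancelled by the central projection of
  the second chart, so the change of charts depends on the derivative of the transition map of the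
  base only.\<close>

definition sphere_transition ::
  "('x, real^7) chart \<Rightarrow> ('x, real^7) chart \<Rightarrow> (real^7 \<Rightarrow> real \<times> (real^6)) \<Rightarrow>
   (real^7 \<Rightarrow> real \<times> (real^6)) \<Rightarrow> (real^7) \<times> (real^6) \<Rightarrow> real \<times> (real^6)" where
  "sphere_transition \<kappa> \<mu> \<Phi> \<Psi> s =
     \<Psi> (frechet_derivative (transition \<kappa> \<mu>) (at (fst s)) (inv \<Phi> (1, snd s)))"

lemma sphere_transition_ray:
  assumes \<Phi>: "linear \<Phi>" "bij \<Phi>" and \<Psi>: "linear \<Psi>" and "\<kappa> \<in> A" "\<mu> \<in> A"
    and \<nu>: "(x, \<nu>) \<in> fst (sphere_chart A g \<kappa> \<Phi>)" and x: "x \<in> fst \<mu>"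
  shows "\<Psi> (\<nu> \<mu>) =
    fst (\<Phi> (\<nu> \<kappa>)) *\<^sub>R sphere_transition \<kappa> \<mu> \<Phi> \<Psi> (snd (sphere_chart A g \<kappa> \<Phi>) (x, \<nu>))"
proof -
  have x\<kappa>: "x \<in> fst \<kappa>" and T: "\<nu> \<in> tangent_space A x" using \<nu> by (simp_all add: sphere_chart_domain)
  let ?D = "frechet_derivative (transition \<kappa> \<mu>) (at (snd \<kappa> x))"
  have lin: "linear ?D" by (rule transition_linear) (use assms atlas x\<kappa> in auto)
  have "\<nu> \<mu> = ?D (\<nu> \<kappa>)" by (rule tangent_space_transition[OF T]) (use assms x\<kappa> in auto)
  also have "\<dots> = ?D (fst (\<Phi> (\<nu> \<kappa>)) *\<^sub>R inv \<Phi> (1, central (\<Phi> (\<nu> \<kappa>))))"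
    using sphere_chart_ray[OF \<Phi> \<nu>] by metis
  finally show ?thesis
    by (simp add: linear_scale[OF lin] linear_scale[OF \<Psi>] sphere_transition_def sphere_chart_map)
qed

lemma transition_smooth:
  assumes "\<kappa> \<in> A" "\<mu> \<in> A"
  shows "open (snd \<kappa> ` (fst \<kappa> \<inter> fst \<mu>))"
    and "smooth_on (snd \<kappa> ` (fst \<kappa> \<inter> fst \<mu>)) (transition \<kappa> \<mu>)"
  using atlas assms unfolding smooth_atlas_def by blast+

lemma smooth_on_sphere_transition:
  assumes \<Phi>: "linear \<Phi>" "bij \<Phi>" and \<Psi>: "linear \<Psi>" and A: "\<kappa> \<in> A" "\<mu> \<in> A"
  shows "smooth_on (snd \<kappa> ` (fst \<kappa> \<inter> fst \<mu>) \<times> UNIV) (sphere_transition \<kappa> \<mu> \<Phi> \<Psi>)"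
proof -
  let ?S = "snd \<kappa> ` (fst \<kappa> \<inter> fst \<mu>) \<times> (UNIV :: (real^6) set)"
  have S: "open ?S" using transition_smooth(1)[OF A] by (simp add: open_Times)
  note id = smooth_on_ident[OF S]
  show ?thesis
    unfolding sphere_transition_def
  proof (intro smooth_on_linear[OF \<Psi> S] smooth_on_frechet_apply[OF S transition_smooth(2)[OF A]]
      smooth_on_linear[OF linear_inv[OF \<Phi>] S] smooth_on_Pair smooth_on_const S
      smooth_on_linear[OF linear_fst S id] smooth_on_linear[OF linear_snd S id])
  qed auto
qed

lemma sphere_overlap:
  assumes \<Phi>: "linear \<Phi>" "bij \<Phi>" and \<Psi>: "linear \<Psi>" and A: "\<kappa> \<in> A" "\<mu> \<in> A"
  shows "snd (sphere_chart A g \<kappa> \<Phi>) ` (fst (sphere_chart A g \<kappa> \<Phi>) \<inter> fst (sphere_chart A g \<mu> \<Psi>)) =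
    {s \<in> snd \<kappa> ` (fst \<kappa> \<inter> fst \<mu>) \<times> UNIV. 0 < fst (sphere_transition \<kappa> \<mu> \<Phi> \<Psi> s)}"
    (is "snd ?sc ` (_ \<inter> fst ?sd) = ?r")
proof -
  have eq: "(x, \<nu>) \<in> fst ?sd \<longleftrightarrow> 0 < fst (sphere_transition \<kappa> \<mu> \<Phi> \<Psi> (snd ?sc (x, \<nu>)))"
    if "(x, \<nu>) \<in> fst ?sc" "x \<in> fst \<mu>" for x \<nu>
    using that sphere_transition_ray[OF \<Phi> \<Psi> A that]
    by (simp add: sphere_chart_domain zero_less_mult_iff)
  have "snd ?sc ` (fst ?sc \<inter> fst ?sd) =
      {s \<in> snd ?sc ` (fst ?sc \<inter> fst -` fst \<mu>). 0 < fst (sphere_transition \<kappa> \<mu> \<Phi> \<Psi> s)}"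
    using eq by (force simp: sphere_chart_domain)
  then show ?thesis unfolding sphere_chart_image[OF \<Phi> A(1)] .
qed

lemma sphere_bundle_cases:
  assumes "\<tau> \<in> sphere_bundle A g"
  obtains \<kappa> \<Phi> where "\<kappa> \<in> A" "linear \<Phi>" "bij \<Phi>" "\<tau> = sphere_chart A g \<kappa> \<Phi>"
  using assms unfolding sphere_bundle_def by blast

lemma smooth_atlas_sphere_bundle: "smooth_atlas (sphere_bundle A g)"
  unfolding smooth_atlas_def
proof (intro conjI ballI)
  fix \<tau> assume "\<tau> \<in> sphere_bundle A g"
  then obtain \<kappa> \<Phi> where \<kappa>: "\<kappa> \<in> A" and \<Phi>: "linear \<Phi>" "bij \<Phi>" and \<tau>: "\<tau> = sphere_chart A g \<kappa> \<Phi>"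
    by (rule sphere_bundle_cases)
  show inj: "inj_on (snd \<tau>) (fst \<tau>)" unfolding \<tau> by (rule sphere_chart_inj[OF \<Phi> \<kappa>])
  show "open (snd \<tau> ` fst \<tau>)"
    using sphere_chart_image[OF \<Phi> \<kappa>, of UNIV] transition_smooth(1)[OF \<kappa> \<kappa>]
    unfolding \<tau> by (simp add: open_Times)
  fix \<sigma> assume "\<sigma> \<in> sphere_bundle A g"
  then obtain \<mu> \<Psi> where \<mu>: "\<mu> \<in> A" and \<Psi>: "linear \<Psi>" "bij \<Psi>" and \<sigma>: "\<sigma> = sphere_chart A g \<mu> \<Psi>"
    by (rule sphere_bundle_cases)
  let ?W = "snd \<kappa> ` (fst \<kappa> \<inter> fst \<mu>) \<times> (UNIV :: (real^6) set)"
    and ?t = "sphere_transition \<kappa> \<mu> \<Phi> \<Psi>"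
  have W: "open ?W" using transition_smooth(1)[OF \<kappa> \<mu>] by (simp add: open_Times)
  have t: "smooth_on ?W ?t" by (rule smooth_on_sphere_transition[OF \<Phi> \<Psi>(1) \<kappa> \<mu>])
  have img: "snd \<tau> ` (fst \<tau> \<inter> fst \<sigma>) = {s \<in> ?W. 0 < fst (?t s)}"
    unfolding \<tau> \<sigma> by (rule sphere_overlap[OF \<Phi> \<Psi>(1) \<kappa> \<mu>])
  show o: "open (snd \<tau> ` (fst \<tau> \<inter> fst \<sigma>))"
    unfolding img by (intro open_positive W continuous_on_fst smooth_on_continuous t)
  show "smooth_on (snd \<tau> ` (fst \<tau> \<inter> fst \<sigma>)) (transition \<tau> \<sigma>)"
  proof (rule smooth_on_cong[OF _ o])
    have sub: "snd \<tau> ` (fst \<tau> \<inter> fst \<sigma>) \<subseteq> ?W" unfolding img by blast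
    show "smooth_on (snd \<tau> ` (fst \<tau> \<inter> fst \<sigma>)) (\<lambda>s. (transition \<kappa> \<mu> (fst s), central (?t s)))"
    proof (intro smooth_on_Pair smooth_on_central o smooth_on_subset[OF t sub]
        smooth_on_compose[OF o _ transition_smooth(2)[OF \<kappa> \<mu>]]
        smooth_on_linear[OF linear_fst o smooth_on_ident[OF o]])
      show "fst ` (snd \<tau> ` (fst \<tau> \<inter> fst \<sigma>)) \<subseteq> snd \<kappa> ` (fst \<kappa> \<inter> fst \<mu>)"
        using sub by force
      show "fst (?t s) \<noteq> 0" if "s \<in> snd \<tau> ` (fst \<tau> \<inter> fst \<sigma>)" for s
        using that unfolding img by simp
    qed
    fix s assume "s \<in> snd \<tau> ` (fst \<tau> \<inter> fst \<sigma>)"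
    then obtain x \<nu> where x: "(x, \<nu>) \<in> fst \<tau>" "(x, \<nu>) \<in> fst \<sigma>" and s: "s = snd \<tau> (x, \<nu>)"
      by auto
    have x\<kappa>: "x \<in> fst \<kappa>" "fst (\<Phi> (\<nu> \<kappa>)) > 0" "x \<in> fst \<mu>"
      using x unfolding \<tau> \<sigma> by (simp_all add: sphere_chart_domain)
    have "transition \<tau> \<sigma> s = snd \<sigma> (x, \<nu>)" unfolding s by (rule local_rep_at[OF inj x(1)])
    also have "\<dots> = (snd \<mu> x, central (\<Psi> (\<nu> \<mu>)))" unfolding \<sigma> by (rule sphere_chart_map)
    also have "central (\<Psi> (\<nu> \<mu>)) = central (?t s)"
      using sphere_transition_ray[OF \<Phi> \<Psi>(1) \<kappa> \<mu> x(1)[unfolded \<tau>] x\<kappa>(3)] x\<kappa>(2)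
      by (simp add: s \<tau> central_scale)
    also have "snd \<mu> x = transition \<kappa> \<mu> (fst s)"
      using local_rep_at[OF smooth_atlas_inj[OF atlas \<kappa>] x\<kappa>(1), of \<mu> "\<lambda>x. x"]
      by (simp add: s \<tau> sphere_chart_map)
    finally show "(transition \<kappa> \<mu> (fst s), central (?t s)) = transition \<tau> \<sigma> s" ..
  qed
qed

lemma smooth_map_bundle_proj: "smooth_map (sphere_bundle A g) A bundle_proj"
  unfolding smooth_map_def
proof (intro conjI ballI)
  show "fst ` points (sphere_bundle A g) \<subseteq> points A"
  proof clarify
    fix x \<nu> assume "(x, \<nu>) \<in> points (sphere_bundle A g)"
    then obtain \<tau> where "\<tau> \<in> sphere_bundle A g" "(x, \<nu>) \<in> fst \<tau>" by (rule points_chart)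
    then obtain \<kappa> \<Phi> where "\<kappa> \<in> A" "(x, \<nu>) \<in> fst (sphere_chart A g \<kappa> \<Phi>)"
      by (metis sphere_bundle_cases)
    then show "fst (x, \<nu>) \<in> points A" unfolding points_def by (auto simp: sphere_chart_domain)
  qed
  fix \<tau> \<mu> assume "\<tau> \<in> sphere_bundle A g" and \<mu>: "\<mu> \<in> A"
  then obtain \<kappa> \<Phi> where \<kappa>: "\<kappa> \<in> A" and \<Phi>: "linear \<Phi>" "bij \<Phi>" and \<tau>: "\<tau> = sphere_chart A g \<kappa> \<Phi>"
    by (elim sphere_bundle_cases)
  have img: "snd \<tau> ` (fst \<tau> \<inter> fst -` fst \<mu>) = snd \<kappa> ` (fst \<kappa> \<inter> fst \<mu>) \<times> UNIV"
    unfolding \<tau> by (rule sphere_chart_image[OF \<Phi> \<kappa>])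
  show o: "open (snd \<tau> ` (fst \<tau> \<inter> fst -` fst \<mu>))"
    unfolding img using transition_smooth(1)[OF \<kappa> \<mu>] by (simp add: open_Times)
  show "smooth_on (snd \<tau> ` (fst \<tau> \<inter> fst -` fst \<mu>)) (local_rep \<tau> \<mu> fst)"
  proof (rule smooth_on_cong[OF _ o])
    show "smooth_on (snd \<tau> ` (fst \<tau> \<inter> fst -` fst \<mu>)) (\<lambda>s. transition \<kappa> \<mu> (fst s))"
      by (intro smooth_on_compose[OF o _ transition_smooth(2)[OF \<kappa> \<mu>]]
          smooth_on_linear[OF linear_fst o smooth_on_ident[OF o]]) (auto simp: img)
    fix s assume "s \<in> snd \<tau> ` (fst \<tau> \<inter> fst -` fst \<mu>)"
    then obtain x \<nu> where x: "(x, \<nu>) \<in> fst \<tau>" "x \<in> fst \<mu>" and s: "s = snd \<tau> (x, \<nu>)"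
      by auto
    have "x \<in> fst \<kappa>" using x unfolding \<tau> by (simp add: sphere_chart_domain)
    then have "transition \<kappa> \<mu> (fst s) = snd \<mu> x"
      using local_rep_at[OF smooth_atlas_inj[OF atlas \<kappa>], of x \<mu> "\<lambda>x. x"]
      by (simp add: s \<tau> sphere_chart_map)
    moreover have "local_rep \<tau> \<mu> fst s = snd \<mu> x"
      using local_rep_at[OF sphere_chart_inj[OF \<Phi> \<kappa>] x(1)[unfolded \<tau>], of \<mu> fst]
      by (simp add: s \<tau>)
    ultimately show "transition \<kappa> \<mu> (fst s) = local_rep \<tau> \<mu> fst s" by simp
  qed
qed

text \<open>Rotating the given vector onto a positive multiple of the preimage of \<open>(1, 0)\<close> yields a half
  space that contains it, so every unit vector lies in the domain of some chart of the sphere bundle.\<close>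

lemma half_space_exists:
  assumes "b \<noteq> (0 :: real^7)"
  obtains \<Phi> :: "real^7 \<Rightarrow> real \<times> (real^6)" where "linear \<Phi>" "bij \<Phi>" "fst (\<Phi> b) > 0"
proof -
  have "dim (UNIV :: (real^7) set) = dim (UNIV :: (real \<times> (real^6)) set)"
    by simp
  then obtain \<Phi> :: "real^7 \<Rightarrow> real \<times> (real^6)" where \<Phi>: "linear \<Phi>" "bij \<Phi>"
    using subspace_isomorphism[OF subspace_UNIV subspace_UNIV] unfolding bij_def by blast
  define d where "d = inv \<Phi> (1, 0)"
  have \<Phi>d: "\<Phi> d = (1, 0)" unfolding d_def using bij_is_surj[OF \<Phi>(2)] by (rule surj_f_inv_f)
  then have "d \<noteq> 0" using linear_0[OF \<Phi>(1)] by (auto simp: zero_prod_def)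
  define k where "k = norm b / norm d"
  have "k > 0" "norm b = norm (k *\<^sub>R d)" using \<open>d \<noteq> 0\<close> assms by (simp_all add: k_def)
  then obtain R where R: "orthogonal_transformation R" "R b = k *\<^sub>R d"
    using orthogonal_transformation_exists by metis
  show thesis
  proof
    show "linear (\<Phi> \<circ> R)"
      using linear_compose[OF orthogonal_transformation_linear[OF R(1)] \<Phi>(1)] .
    show "bij (\<Phi> \<circ> R)" using orthogonal_transformation_bij[OF R(1)] \<Phi>(2) by (rule bij_comp)
    show "fst ((\<Phi> \<circ> R) b) > 0" using \<open>k > 0\<close> by (simp add: R(2) linear_scale[OF \<Phi>(1)] \<Phi>d)
  qed
qed

lemma unit_vector_in_sphere_bundle:
  assumes \<kappa>: "\<kappa> \<in> A" "x \<in> fst \<kappa>" and \<nu>: "\<nu> \<in> tangent_space A x" "g x \<nu> \<nu> = 1"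
  shows "(x, \<nu>) \<in> points (sphere_bundle A g)"
proof -
  have "\<nu> \<kappa> \<noteq> 0"
  proof
    assume "\<nu> \<kappa> = 0"
    then have "\<nu> = coord_vec A \<kappa> x (0 *\<^sub>R 0)" using coord_vec_of_coord[OF \<nu>(1) \<kappa>] by simp
    then show False using metric_square(1)[OF \<kappa>, of 0 0] \<nu>(2) by simp
  qed
  then obtain \<Phi> :: "real^7 \<Rightarrow> real \<times> (real^6)"
    where "linear \<Phi>" "bij \<Phi>" "fst (\<Phi> (\<nu> \<kappa>)) > 0" by (rule half_space_exists)
  then have "sphere_chart A g \<kappa> \<Phi> \<in> sphere_bundle A g"
    using \<kappa>(1) unfolding sphere_bundle_def by blast
  moreover have "(x, \<nu>) \<in> fst (sphere_chart A g \<kappa> \<Phi>)"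
    using \<kappa> \<nu> \<open>fst _ > 0\<close> by (simp add: sphere_chart_domain)
  ultimately show ?thesis unfolding points_def by blast
qed

end

section \<open>The Gauss lift\<close>

lemma linear_on_plane:
  fixes D :: "real^2 \<Rightarrow> 'a::real_vector"
  assumes "linear D"
  shows "D v = (v $ 1) *\<^sub>R D (axis 1 1) + (v $ 2) *\<^sub>R D (axis 2 1)"
proof -
  have "v = (v $ 1) *\<^sub>R axis 1 1 + (v $ 2) *\<^sub>R axis 2 1"
    by (simp add: vec_eq_iff forall_2 axis_def)
  then have "D v = D ((v $ 1) *\<^sub>R axis 1 1 + (v $ 2) *\<^sub>R axis 2 1)" by simp
  then show ?thesis by (simp only: linear_add[OF assms] linear_scale[OF assms])
qed

lemma det_rows: "det (vector [u, v] :: real^2^2) = u $ 1 * v $ 2 - u $ 2 * v $ 1"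
  by (simp add: det_2)

lemma det_linear_image:
  fixes M :: "real^2 \<Rightarrow> real^2"
  assumes "linear M"
  shows "det (vector [M u, M v] :: real^2^2) = det (matrix M) * det (vector [u, v] :: real^2^2)"
  unfolding det_rows linear_on_plane[OF assms, of u] linear_on_plane[OF assms, of v]
  by (simp add: det_2 matrix_def algebra_simps)

text \<open>Coordinates change by a map of positive determinant, so one chart decides the orientation.\<close>

lemma oriented_basis_iff:
  assumes B: "oriented_surface B" and \<kappa>: "\<kappa> \<in> B" "p \<in> fst \<kappa>"
  shows "(a, b) \<in> oriented_bases B p \<longleftrightarrow>
    a \<in> tangent_space B p \<and> b \<in> tangent_space B p \<and> det (vector [a \<kappa>, b \<kappa>] :: real^2^2) > 0"
    (is "?l \<longleftrightarrow> ?r")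
proof
  assume ?l
  then show ?r using \<kappa> unfolding oriented_bases_def by blast
next
  assume r: ?r
  have atlas: "smooth_atlas B"
    using B unfolding oriented_surface_def smooth_manifold_def by blast
  have "det (vector [a \<mu>, b \<mu>] :: real^2^2) > 0" if \<mu>: "\<mu> \<in> B" "p \<in> fst \<mu>" for \<mu>
  proof -
    let ?D = "frechet_derivative (transition \<kappa> \<mu>) (at (snd \<kappa> p))"
    have "a \<mu> = ?D (a \<kappa>)" "b \<mu> = ?D (b \<kappa>)"
      using r by (auto intro: tangent_space_transition[OF _ \<kappa> \<mu>])
    moreover have "linear ?D" by (rule transition_linear[OF atlas \<kappa> \<mu>])
    moreover have "det (matrix ?D) > 0"
      using B \<kappa> \<mu> unfolding oriented_surface_def by blast
    ultimately show ?thesis using r by (simp add: det_linear_image)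
  qed
  with r show ?l unfolding oriented_bases_def by blast
qed

locale immersed_surface =
  fixes A :: "('x, real^7) chart set"
    and \<phi> :: "('x, real^7) trilinear_field"
    and g :: "('x, real^7) bilinear_field"
    and B :: "('s, real^2) chart set"
    and f :: "'s \<Rightarrow> 'x"
  assumes g2: "g2_manifold A \<phi> g" and surface: "oriented_surface B" and imm: "immersion B A f"
begin

lemma atlas_A: "smooth_atlas A" and atlas_B: "smooth_atlas B"
  using g2 surface unfolding g2_manifold_def oriented_surface_def smooth_manifold_def by blast+

lemma f_smooth: "smooth_map B A f"
  using imm unfolding immersion_def by blast

sublocale riemannian_atlas A g
  using g2 atlas_A unfolding g2_manifold_def by unfold_locales blast+

definition tangent_map ::
  "('s, real^2) chart \<Rightarrow> ('x, real^7) chart \<Rightarrow> real^2 \<Rightarrow> real^2 \<Rightarrow> real^7" where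
  "tangent_map \<kappa> \<mu> s = frechet_derivative (local_rep \<kappa> \<mu> f) (at s)"

definition gram_matrix ::
  "('s, real^2) chart \<Rightarrow> ('x, real^7) chart \<Rightarrow> real^2 \<Rightarrow> real^7^7" where
  "gram_matrix \<kappa> \<mu> s = (\<chi> i j. metric_coeff A g \<mu> i j (local_rep \<kappa> \<mu> f s))"

definition cross_form ::
  "('s, real^2) chart \<Rightarrow> ('x, real^7) chart \<Rightarrow> real^2 \<Rightarrow> real^7" where
  "cross_form \<kappa> \<mu> s = (\<chi> i. \<Sum>j\<in>UNIV. \<Sum>k\<in>UNIV. form_coeff A \<phi> \<mu> i j k (local_rep \<kappa> \<mu> f s) *
     (tangent_map \<kappa> \<mu> s (axis 1 1) $ j * tangent_map \<kappa> \<mu> s (axis 2 1) $ k))"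

text \<open>With \<open>U\<close> and \<open>V\<close> the images under \<open>f\<close> of the two coordinate fields of \<open>\<kappa>\<close>, \<open>cross_form\<close> is the
  covector \<open>\<phi> (\<cdot>, U, V)\<close>, and raising its index gives \<open>normal_field\<close>, the coordinates of the cross
  product \<open>U \<times> V\<close>. This vector is not normalised.\<close>

definition normal_field ::
  "('s, real^2) chart \<Rightarrow> ('x, real^7) chart \<Rightarrow> real^2 \<Rightarrow> real^7" where
  "normal_field \<kappa> \<mu> s = matrix_inv (gram_matrix \<kappa> \<mu> s) *v cross_form \<kappa> \<mu> s"

definition overlap ::
  "('s, real^2) chart \<Rightarrow> ('x, real^7) chart \<Rightarrow> (real^2) set" where
  "overlap \<kappa> \<mu> = snd \<kappa> ` (fst \<kappa> \<inter> f -` fst \<mu>)"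

lemma local_rep_smooth:
  assumes "\<kappa> \<in> B" "\<mu> \<in> A"
  shows "open (overlap \<kappa> \<mu>)" "smooth_on (overlap \<kappa> \<mu>) (local_rep \<kappa> \<mu> f)"
  using f_smooth assms unfolding overlap_def smooth_map_def by blast+

lemma local_rep_image:
  assumes "\<kappa> \<in> B" "\<mu> \<in> A"
  shows "local_rep \<kappa> \<mu> f ` overlap \<kappa> \<mu> \<subseteq> snd \<mu> ` fst \<mu>"
  unfolding overlap_def by (auto simp: local_rep_at[OF smooth_atlas_inj[OF atlas_B assms(1)]])

lemma smooth_on_tangent_map:
  "\<kappa> \<in> B \<Longrightarrow> \<mu> \<in> A \<Longrightarrow> smooth_on (overlap \<kappa> \<mu>) (\<lambda>s. tangent_map \<kappa> \<mu> s v)"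
  unfolding tangent_map_def by (intro smooth_on_frechet_derivative local_rep_smooth)

lemma gram_matrix_det:
  assumes \<kappa>: "\<kappa> \<in> B" "p \<in> fst \<kappa>" and \<mu>: "\<mu> \<in> A" "f p \<in> fst \<mu>"
  shows "det (gram_matrix \<kappa> \<mu> (snd \<kappa> p)) \<noteq> 0"
proof -
  interpret Q: g2_chart A \<phi> g \<mu> "f p" by unfold_locales (use g2 \<mu> in auto)
  show ?thesis
    using Q.metric_matrix_det
    unfolding gram_matrix_def local_rep_at[OF smooth_atlas_inj[OF atlas_B \<kappa>(1)] \<kappa>(2)] .
qed

lemma gram_matrix_normal_field:
  assumes "\<kappa> \<in> B" "\<mu> \<in> A" "s \<in> overlap \<kappa> \<mu>"
  shows "gram_matrix \<kappa> \<mu> s *v normal_field \<kappa> \<mu> s = cross_form \<kappa> \<mu> s"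
proof -
  let ?M = "gram_matrix \<kappa> \<mu> s"
  have "invertible ?M"
    using assms gram_matrix_det unfolding overlap_def invertible_det_nz by blast
  then have "?M ** matrix_inv ?M = mat 1"
    unfolding invertible_def matrix_inv_def by (rule someI_ex[THEN conjunct1])
  then show ?thesis
    unfolding normal_field_def by (simp add: matrix_vector_mul_assoc)
qed

lemma smooth_on_normal_field:
  assumes \<kappa>\<mu>: "\<kappa> \<in> B" "\<mu> \<in> A"
  shows "smooth_on (overlap \<kappa> \<mu>) (normal_field \<kappa> \<mu>)"
proof -
  note S = local_rep_smooth(1)[OF \<kappa>\<mu>]
  note compose = smooth_on_compose[OF S local_rep_smooth(2)[OF \<kappa>\<mu>] _ local_rep_image[OF \<kappa>\<mu>]]
  have metric: "smooth_on (snd \<mu> ` fst \<mu>) (metric_coeff A g \<mu> i j)"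
    and form: "smooth_on (snd \<mu> ` fst \<mu>) (form_coeff A \<phi> \<mu> i j k)" for i j k
    using g2 \<kappa>\<mu>(2) unfolding g2_manifold_def riemannian_metric_def smooth_three_form_def by blast+
  show ?thesis
  proof (rule smooth_on_linear_solve[OF S])
    show "gram_matrix \<kappa> \<mu> s *v normal_field \<kappa> \<mu> s = cross_form \<kappa> \<mu> s" if "s \<in> overlap \<kappa> \<mu>" for s
      by (rule gram_matrix_normal_field[OF \<kappa>\<mu> that])
    show "det (gram_matrix \<kappa> \<mu> s) \<noteq> 0" if "s \<in> overlap \<kappa> \<mu>" for s
      using that gram_matrix_det \<kappa>\<mu> unfolding overlap_def by blast
    show "smooth_on (overlap \<kappa> \<mu>) (\<lambda>s. gram_matrix \<kappa> \<mu> s $ i $ j)" for i j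
      using compose[OF metric] by (simp add: gram_matrix_def)
    have "smooth_on (overlap \<kappa> \<mu>) (\<lambda>s. \<Sum>j\<in>UNIV. \<Sum>k\<in>UNIV.
        form_coeff A \<phi> \<mu> i j k (local_rep \<kappa> \<mu> f s) *
        (tangent_map \<kappa> \<mu> s (axis 1 1) $ j * tangent_map \<kappa> \<mu> s (axis 2 1) $ k))" for i
      by (intro smooth_on_sum smooth_on_mult smooth_on_nth smooth_on_tangent_map S compose form \<kappa>\<mu>)
    then show "smooth_on (overlap \<kappa> \<mu>) (\<lambda>s. cross_form \<kappa> \<mu> s $ i)" for i
      by (simp add: cross_form_def)
  qed
qed

context
  fixes \<kappa> :: "('s, real^2) chart" and \<mu> :: "('x, real^7) chart" and p :: 's
  assumes \<kappa>: "\<kappa> \<in> B" "p \<in> fst \<kappa>" and \<mu>: "\<mu> \<in> A" "f p \<in> fst \<mu>"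
begin

interpretation Q: g2_chart A \<phi> g \<mu> "f p"
  by unfold_locales (use g2 \<mu> in auto)

private abbreviation "D \<equiv> tangent_map \<kappa> \<mu> (snd \<kappa> p)"
private abbreviation "z \<equiv> normal_field \<kappa> \<mu> (snd \<kappa> p)"

lemma p_point: "p \<in> points B"
  using \<kappa> unfolding points_def by blast

lemma tangent_map_linear: "linear D"
  unfolding tangent_map_def
  by (rule has_derivative_linear[OF smooth_map_has_derivative[OF f_smooth \<kappa>(1) \<mu>(1) \<kappa>(2) \<mu>(2)]])

lemma differential_coords:
  assumes "a \<in> tangent_space B p"
  shows "differential B A f p a = Q.of_coords (D (a \<kappa>))"
  using Q.of_coords_of_coord[OF differential_tangent[OF atlas_B atlas_A f_smooth p_point assms]]
    differential_in_chart[OF atlas_B f_smooth assms \<kappa> \<mu>]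
  by (simp add: tangent_map_def)

lemma tangent_basis_independent:
  assumes "\<alpha> *\<^sub>R D (axis 1 1) + \<beta> *\<^sub>R D (axis 2 1) = 0"
  shows "\<alpha> = 0 \<and> \<beta> = 0"
proof -
  let ?v = "vector [\<alpha>, \<beta>] :: real^2" and ?c = "coord_vec B \<kappa> p"
  note T = coord_vec_tangent[OF atlas_B \<kappa>] and c = coord_vec_coord[OF atlas_B \<kappa>]
  have "D ?v = D 0"
    using assms linear_on_plane[OF tangent_map_linear, of ?v] linear_0[OF tangent_map_linear] by simp
  then have "differential B A f p (?c ?v) = differential B A f p (?c 0)"
    by (simp add: differential_coords T c)
  then have "?c ?v = ?c 0"
    using imm p_point T unfolding immersion_def inj_on_def by blast
  then have "?v = 0" using c by metis
  then have "?v $ 1 = 0" "?v $ 2 = 0" by simp_all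
  then show ?thesis by simp
qed

lemma oriented_bases_image:
  "(\<lambda>(a, b). (differential B A f p a, differential B A f p b)) ` oriented_bases B p =
    {(Q.of_coords (\<alpha> *\<^sub>R D (axis 1 1) + \<beta> *\<^sub>R D (axis 2 1)),
      Q.of_coords (\<gamma> *\<^sub>R D (axis 1 1) + \<delta> *\<^sub>R D (axis 2 1))) | \<alpha> \<beta> \<gamma> \<delta>. \<alpha> * \<delta> - \<beta> * \<gamma> > 0}"
    (is "?l = ?r")
proof
  show "?l \<subseteq> ?r"
  proof clarify
    fix a b assume "(a, b) \<in> oriented_bases B p"
    then have ab: "a \<in> tangent_space B p" "b \<in> tangent_space B p"
      "a \<kappa> $ 1 * b \<kappa> $ 2 - a \<kappa> $ 2 * b \<kappa> $ 1 > 0"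
      unfolding oriented_basis_iff[OF surface \<kappa>] det_rows by blast+
    have "differential B A f p c =
        Q.of_coords ((c \<kappa> $ 1) *\<^sub>R D (axis 1 1) + (c \<kappa> $ 2) *\<^sub>R D (axis 2 1))"
      if "c \<in> tangent_space B p" for c
      unfolding differential_coords[OF that] linear_on_plane[OF tangent_map_linear, of "c \<kappa>"] ..
    with ab show "\<exists>\<alpha> \<beta> \<gamma> \<delta>. (differential B A f p a, differential B A f p b) =
      (Q.of_coords (\<alpha> *\<^sub>R D (axis 1 1) + \<beta> *\<^sub>R D (axis 2 1)),
       Q.of_coords (\<gamma> *\<^sub>R D (axis 1 1) + \<delta> *\<^sub>R D (axis 2 1))) \<and> \<alpha> * \<delta> - \<beta> * \<gamma> > 0"
      by blast
  qed
  show "?r \<subseteq> ?l"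
  proof clarify
    fix \<alpha> \<beta> \<gamma> \<delta> :: real assume pos: "\<alpha> * \<delta> - \<beta> * \<gamma> > 0"
    let ?a = "coord_vec B \<kappa> p (vector [\<alpha>, \<beta>])" and ?b = "coord_vec B \<kappa> p (vector [\<gamma>, \<delta>])"
    note T = coord_vec_tangent[OF atlas_B \<kappa>] and c = coord_vec_coord[OF atlas_B \<kappa>]
    have "(?a, ?b) \<in> oriented_bases B p"
      unfolding oriented_basis_iff[OF surface \<kappa>] det_rows c using T pos by simp
    moreover have "differential B A f p ?a = Q.of_coords (\<alpha> *\<^sub>R D (axis 1 1) + \<beta> *\<^sub>R D (axis 2 1))"
      "differential B A f p ?b = Q.of_coords (\<gamma> *\<^sub>R D (axis 1 1) + \<delta> *\<^sub>R D (axis 2 1))"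
      using linear_on_plane[OF tangent_map_linear, of "vector [\<alpha>, \<beta>]"]
        linear_on_plane[OF tangent_map_linear, of "vector [\<gamma>, \<delta>]"]
      by (simp_all add: differential_coords[OF T] c)
    ultimately show "(Q.of_coords (\<alpha> *\<^sub>R D (axis 1 1) + \<beta> *\<^sub>R D (axis 2 1)),
        Q.of_coords (\<gamma> *\<^sub>R D (axis 1 1) + \<delta> *\<^sub>R D (axis 2 1))) \<in> ?l"
      by force
  qed
qed

lemma normal_field_cross: "Q.G u z = Q.P u (D (axis 1 1)) (D (axis 2 1))"
proof -
  obtain w where w: "\<And>u. Q.G u w = Q.P u (D (axis 1 1)) (D (axis 2 1))"
    using Q.cross_exists[of "D (axis 1 1)" "D (axis 2 1)"] by blast
  note rep = local_rep_at[OF smooth_atlas_inj[OF atlas_B \<kappa>(1)] \<kappa>(2)]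
  have "gram_matrix \<kappa> \<mu> (snd \<kappa> p) *v w = cross_form \<kappa> \<mu> (snd \<kappa> p)"
    using Q.metric_matrix_solve[OF w] unfolding gram_matrix_def cross_form_def rep .
  also have "\<dots> = gram_matrix \<kappa> \<mu> (snd \<kappa> p) *v z"
    by (rule gram_matrix_normal_field[symmetric]) (use \<kappa> \<mu> in \<open>auto simp: overlap_def\<close>)
  finally have "w = z"
    using gram_matrix_det[OF \<kappa> \<mu>] by (metis inj_matrix_vector_mult injD invertible_det_nz)
  then show ?thesis using w by simp
qed

lemma gauss_lift_coords:
  obtains r where "r > 0" "gauss_lift B A \<phi> g f p = (f p, Q.of_coords (r *\<^sub>R z))"
    "g (f p) (Q.of_coords (r *\<^sub>R z)) (Q.of_coords (r *\<^sub>R z)) = 1"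
  using Q.plane_normal_vec[OF tangent_basis_independent normal_field_cross]
  unfolding gauss_lift_def oriented_bases_image Q.G_def by blast

lemma gauss_lift_in_sphere_bundle: "gauss_lift B A \<phi> g f p \<in> points (sphere_bundle A g)"
proof -
  obtain r where "gauss_lift B A \<phi> g f p = (f p, Q.of_coords (r *\<^sub>R z))"
    "g (f p) (Q.of_coords (r *\<^sub>R z)) (Q.of_coords (r *\<^sub>R z)) = 1"
    by (rule gauss_lift_coords)
  then show ?thesis
    using unit_vector_in_sphere_bundle[OF \<mu> Q.of_coords_tangent] by simp
qed

text \<open>The scalar \<open>r\<close> in the previous description of the lift is positive, so it affects neither
  the half space in which the lift lies nor its central projection.\<close>

lemma gauss_lift_sphere_chart:
  assumes \<Phi>: "linear \<Phi>"
  shows "gauss_lift B A \<phi> g f p \<in> fst (sphere_chart A g \<mu> \<Phi>) \<longleftrightarrow> fst (\<Phi> z) > 0"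
    and "snd (sphere_chart A g \<mu> \<Phi>) (gauss_lift B A \<phi> g f p) = (snd \<mu> (f p), central (\<Phi> z))"
proof -
  obtain r where r: "r > 0" and lift: "gauss_lift B A \<phi> g f p = (f p, Q.of_coords (r *\<^sub>R z))"
    and unit: "g (f p) (Q.of_coords (r *\<^sub>R z)) (Q.of_coords (r *\<^sub>R z)) = 1"
    by (rule gauss_lift_coords)
  have \<Phi>r: "\<Phi> (Q.of_coords (r *\<^sub>R z) \<mu>) = r *\<^sub>R \<Phi> z"
    by (simp add: Q.of_coords_coord linear_scale[OF \<Phi>])
  show "gauss_lift B A \<phi> g f p \<in> fst (sphere_chart A g \<mu> \<Phi>) \<longleftrightarrow> fst (\<Phi> z) > 0"
    unfolding lift sphere_chart_domain \<Phi>r using r \<mu> unit Q.of_coords_tangent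
    by (simp add: zero_less_mult_iff)
  show "snd (sphere_chart A g \<mu> \<Phi>) (gauss_lift B A \<phi> g f p) = (snd \<mu> (f p), central (\<Phi> z))"
    unfolding lift sphere_chart_map \<Phi>r using r by (simp add: central_scale)
qed

text \<open>A tangent vector of the surface maps into the span of the two factors of the cross product,
  and the form vanishes when an argument is repeated.\<close>

lemma gauss_lift_orthogonal:
  assumes "a \<in> tangent_space B p"
  shows "g (f p) (differential B A f p a) (snd (gauss_lift B A \<phi> g f p)) = 0"
proof -
  obtain r where lift: "gauss_lift B A \<phi> g f p = (f p, Q.of_coords (r *\<^sub>R z))"
    by (rule gauss_lift_coords)
  have "Q.G (D (a \<kappa>)) (r *\<^sub>R z) = 0"
    unfolding linear_on_plane[OF tangent_map_linear, of "a \<kappa>"]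
    by (simp add: Q.G_simps normal_field_cross Q.P_simps Q.P_repeat)
  then show ?thesis unfolding lift differential_coords[OF assms] Q.G_def by simp
qed

end

lemma smooth_map_gauss_lift: "smooth_map B (sphere_bundle A g) (gauss_lift B A \<phi> g f)"
  unfolding smooth_map_def
proof (intro conjI ballI)
  let ?L = "gauss_lift B A \<phi> g f"
  show "?L ` points B \<subseteq> points (sphere_bundle A g)"
  proof (rule image_subsetI)
    fix p assume p: "p \<in> points B"
    then obtain \<kappa> where \<kappa>: "\<kappa> \<in> B" "p \<in> fst \<kappa>" by (rule points_chart)
    have "f p \<in> points A" using f_smooth p unfolding smooth_map_def by blast
    then obtain \<mu> where \<mu>: "\<mu> \<in> A" "f p \<in> fst \<mu>" by (rule points_chart)
    show "?L p \<in> points (sphere_bundle A g)" by (rule gauss_lift_in_sphere_bundle[OF \<kappa> \<mu>])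
  qed
  fix \<kappa> \<tau> assume \<kappa>: "\<kappa> \<in> B" and "\<tau> \<in> sphere_bundle A g"
  then obtain \<mu> \<Phi> where \<mu>: "\<mu> \<in> A" and \<Phi>: "linear \<Phi>" "bij \<Phi>" and \<tau>: "\<tau> = sphere_chart A g \<mu> \<Phi>"
    by (elim sphere_bundle_cases)
  note S = local_rep_smooth(1)[OF \<kappa> \<mu>]
  let ?w = "\<lambda>s. \<Phi> (normal_field \<kappa> \<mu> s)"
  have w: "smooth_on (overlap \<kappa> \<mu>) ?w"
    by (rule smooth_on_linear[OF \<Phi>(1) S smooth_on_normal_field[OF \<kappa> \<mu>]])
  have dom: "?L p \<in> fst \<tau> \<longleftrightarrow> f p \<in> fst \<mu> \<and> 0 < fst (?w (snd \<kappa> p))" if "p \<in> fst \<kappa>" for p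
  proof (cases "f p \<in> fst \<mu>")
    case True
    then show ?thesis using gauss_lift_sphere_chart(1)[OF \<kappa> that \<mu> True \<Phi>(1)] \<tau> by simp
  next
    case False
    then show ?thesis by (simp add: \<tau> gauss_lift_def sphere_chart_domain)
  qed
  then have "fst \<kappa> \<inter> ?L -` fst \<tau> = {q \<in> fst \<kappa>. f q \<in> fst \<mu> \<and> 0 < fst (?w (snd \<kappa> q))}"
    by blast
  then have img: "snd \<kappa> ` (fst \<kappa> \<inter> ?L -` fst \<tau>) = {s \<in> overlap \<kappa> \<mu>. 0 < fst (?w s)}"
    unfolding overlap_def by auto
  show o: "open (snd \<kappa> ` (fst \<kappa> \<inter> ?L -` fst \<tau>))"
    unfolding img by (intro open_positive S continuous_on_fst smooth_on_continuous w)
  have sub: "snd \<kappa> ` (fst \<kappa> \<inter> ?L -` fst \<tau>) \<subseteq> overlap \<kappa> \<mu>" unfolding img by blast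
  show "smooth_on (snd \<kappa> ` (fst \<kappa> \<inter> ?L -` fst \<tau>)) (local_rep \<kappa> \<tau> ?L)"
  proof (rule smooth_on_cong[OF _ o])
    show "smooth_on (snd \<kappa> ` (fst \<kappa> \<inter> ?L -` fst \<tau>)) (\<lambda>s. (local_rep \<kappa> \<mu> f s, central (?w s)))"
    proof (intro smooth_on_Pair smooth_on_central o smooth_on_subset[OF w sub]
        smooth_on_subset[OF local_rep_smooth(2)[OF \<kappa> \<mu>] sub])
      show "fst (?w s) \<noteq> 0" if "s \<in> snd \<kappa> ` (fst \<kappa> \<inter> ?L -` fst \<tau>)" for s
        using that unfolding img by simp
    qed
    fix s assume "s \<in> snd \<kappa> ` (fst \<kappa> \<inter> ?L -` fst \<tau>)"
    then obtain p where p: "p \<in> fst \<kappa>" "?L p \<in> fst \<tau>" and s: "s = snd \<kappa> p" by auto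
    note rep = local_rep_at[OF smooth_atlas_inj[OF atlas_B \<kappa>] p(1)]
    have "f p \<in> fst \<mu>" using dom p by blast
    then show "(local_rep \<kappa> \<mu> f s, central (?w s)) = local_rep \<kappa> \<tau> ?L s"
      using gauss_lift_sphere_chart(2)[OF \<kappa> p(1) \<mu> _ \<Phi>(1)] unfolding s rep \<tau> by simp
  qed
qed

text \<open>Functoriality applied to \<open>bundle_proj \<circ> gauss_lift = f\<close>.\<close>

lemma differential_proj_gauss_lift:
  assumes "p \<in> points B" "a \<in> tangent_space B p"
  shows "differential (sphere_bundle A g) A bundle_proj (gauss_lift B A \<phi> g f p)
      (differential B (sphere_bundle A g) (gauss_lift B A \<phi> g f) p a) = differential B A f p a"
proof -
  have "(\<lambda>q. bundle_proj (gauss_lift B A \<phi> g f q)) = f" by (simp add: gauss_lift_def)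
  then show ?thesis
    using differential_compose[OF atlas_B smooth_atlas_sphere_bundle smooth_map_gauss_lift
        smooth_map_bundle_proj assms] by simp
qed

lemma immersion_gauss_lift: "immersion B (sphere_bundle A g) (gauss_lift B A \<phi> g f)"
  unfolding immersion_def
proof (intro conjI ballI smooth_map_gauss_lift)
  fix p assume p: "p \<in> points B"
  show "inj_on (differential B (sphere_bundle A g) (gauss_lift B A \<phi> g f) p) (tangent_space B p)"
  proof (rule inj_onI)
    fix a b assume ab: "a \<in> tangent_space B p" "b \<in> tangent_space B p"
      and "differential B (sphere_bundle A g) (gauss_lift B A \<phi> g f) p a =
        differential B (sphere_bundle A g) (gauss_lift B A \<phi> g f) p b"
    then have "differential B A f p a = differential B A f p b"
      using differential_proj_gauss_lift[OF p] by metis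
    then show "a = b" using imm p ab unfolding immersion_def inj_on_def by blast
  qed
qed

lemma gauss_lift_integral:
  assumes p: "p \<in> points B" and a: "a \<in> tangent_space B p"
  shows "differential B (sphere_bundle A g) (gauss_lift B A \<phi> g f) p a
    \<in> canonical_distribution A g (gauss_lift B A \<phi> g f p)"
proof -
  obtain \<kappa> where \<kappa>: "\<kappa> \<in> B" "p \<in> fst \<kappa>" using p by (rule points_chart)
  have "f p \<in> points A" using f_smooth p unfolding smooth_map_def by blast
  then obtain \<mu> where \<mu>: "\<mu> \<in> A" "f p \<in> fst \<mu>" by (rule points_chart)
  have fst: "bundle_proj (gauss_lift B A \<phi> g f p) = f p" by (simp add: gauss_lift_def)
  show ?thesis
    unfolding canonical_distribution_def orthogonal_complement_def mem_Collect_eq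
      differential_proj_gauss_lift[OF p a] fst
    using differential_tangent[OF atlas_B smooth_atlas_sphere_bundle smooth_map_gauss_lift p a]
      differential_tangent[OF atlas_B atlas_A f_smooth p a] gauss_lift_orthogonal[OF \<kappa> \<mu> a] by simp
qed

end

theorem proposition5p1:
  fixes A :: "('x, real^7) chart set"
    and \<phi> :: "('x, real^7) trilinear_field"
    and g :: "('x, real^7) bilinear_field"
    and B :: "('s, real^2) chart set"
    and f :: "'s \<Rightarrow> 'x"
  assumes "g2_manifold A \<phi> g"
    and "oriented_surface B"
    and "immersion B A f"
  shows "immersion B (sphere_bundle A g) (gauss_lift B A \<phi> g f) \<and>
    (\<forall>p\<in>points B.
       differential B (sphere_bundle A g) (gauss_lift B A \<phi> g f) p ` tangent_space B p
         \<subseteq> canonical_distribution A g (gauss_lift B A \<phi> g f p))"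
proof -
  interpret immersed_surface A \<phi> g B f using assms by unfold_locales
  show ?thesis using immersion_gauss_lift gauss_lift_integral by blast
qed

end
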